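(* Let $\boldsymbol{g}=(g_1,\ldots,g_m)$, $\mathbf{h}=(h_1,\ldots,h_s)$ and $F=(f_1,\ldots,f_n)$ be polynomials in $\mathbb{Q}[x_1,\ldots,x_n]$, and let $E$ be the vector space spanned by $\boldsymbol{g}$. On input $\boldsymbol{g}$, $\mathbf{h}$ and $F$, the algorithm $\mathsf{TruncatedClass}$ (described in the context) outputs polynomials (equations and inequations) defining constructible sets $S_1,\ldots,S_k$ of $\mathbb{C}^n$ and lists of polynomials $T_1,\ldots,T_k\subset\mathbb{C}(\mathbf{y})[\mathbf{x}]$, with $\mathbf{x}=(x_1,\ldots,x_n)$ and $\mathbf{y}=(y_1,\ldots,y_n)$, such that: 1. $\mathbb{C}^n=S_1\cup\cdots\cup S_k$; 2. for every $i\in\{1,\ldots,k\}$ and any $\mathbf{a}\in S_i$, the set $\{f(\mathbf{x},\mathbf{a})\mid f\in T_i\}$ (the coefficients of $f$ evaluated at $\mathbf{y}=\mathbf{a}$) is a vector space basis for $I_{\mathcal{L}(\mathbf{a},\mathbf{h},F),E}$. Moreover, if $N$ is the number of loop iterations performed in the call to $\mathsf{InvariantSet}$ made by $\mathsf{ComputeMatrix}$ on input $(\boldsymbol{g},\mathbf{h},F)$, then $k\le\binom{m+N}{N}$.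
   Context: A tuple $F=(f_1,\ldots,f_n)$ of polynomials is identified with the polynomial map it defines; $F^0=\mathrm{id}$, $F^j=F\circ F^{j-1}$. Polynomial loop: $\mathcal{L}(\mathbf{a},\mathbf{h},F)$ is the loop which initializes $\mathbf{x}=\mathbf{a}$ and, while $h_1(\mathbf{x})\neq0,\ldots,h_s(\mathbf{x})\neq 0$, performs $\mathbf{x}\leftarrow F(\mathbf{x})$. A polynomial $g\in\mathbb{C}[\mathbf{x}]$ is a polynomial invariant of the loop if $g=0$ holds before and after each iteration, i.e. $g(F^l(\mathbf{a}))=0$ for every $l\ge 0$ such that $h_i(F^j(\mathbf{a}))\neq0$ for all $i$ and all $0\le j<l$. $I_{\mathcal{L}(\mathbf{a},\mathbf{h},F),E}$ is the vector space of polynomial invariants of the loop lying in $E$. Algorithm $\mathsf{InvariantSet}$, on input a sequence $\boldsymbol{p}$ of polynomials and a polynomial map $G$ over $\mathbb{Q}$: set $S\leftarrow\{\boldsymbol{p}\}$ and $\widetilde{\boldsymbol{p}}\leftarrow\boldsymbol{p}\circ G$; while not all entries of $\widetilde{\boldsymbol{p}}$ belong to the radical of $\langle S\rangle$, set $S\leftarrow S\cup\{\widetilde{\boldsymbol{p}}\}$ and $\widetilde{\boldsymbol{p}}\leftarrow\widetilde{\boldsymbol{p}}\circ G$; return $S$. Its loop iterations are the iterations of this while loop. Algorithm $\mathsf{ComputeMatrix}$, on input $(\boldsymbol{g},\mathbf{h},F)$: with new variables $\mathbf{u}=(u_1,\ldots,u_m)$ and $z$, set $g=u_1g_1+\cdots+u_mg_m$,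 $h=h_1\cdots h_s$, $F_m(\mathbf{x},\mathbf{u},z)=(F(\mathbf{x}),\mathbf{u},z\,h(\mathbf{x}))$; compute the output $P_1,P_2,\ldots$ of $\mathsf{InvariantSet}(zg,F_m)$; return the matrix $A$ over $\mathbb{Q}[\mathbf{x}]$ with $[P_1(\mathbf{x},\mathbf{u},1),P_2(\mathbf{x},\mathbf{u},1),\ldots]^t=A\cdot[u_1,\ldots,u_m]^t$. Algorithm $\mathsf{ParametricSol}$, on input an $r\times m$ matrix $A$ over $\mathbb{Q}[\mathbf{x}]$: for each $t\le\min\{r,m\}$ and each $t\times t$ submatrix $M$ of $A$ that is non-singular over $\mathbb{Q}(\mathbf{x})$, output the constructible set where all $(t+1)\times(t+1)$ minors of $A$ vanish and $\det M\neq0$, together with the matrix $Z$ over $\mathbb{Q}(\mathbf{x})$ which, after permuting rows and columns so that $A=\begin{bmatrix}M&M'\\ R&R'\end{bmatrix}$, equals $\begin{bmatrix}-M^{-1}M'\\ I_{m-t}\end{bmatrix}$ (rows permuted back accordingly). For every $\mathbf{a}$ in that constructible set the columns of $Z(\mathbf{a})$ form a basis of the right kernel $\ker A(\mathbf{a})$. Algorithm $\mathsf{TruncatedClass}$, on input $(\boldsymbol{g},\mathbf{h},F)$: compute $A=\mathsf{ComputeMatrix}(\boldsymbol{g},\mathbf{h},F)$; apply $\mathsf{ParametricSol}(A)$ to obtain (descriptions of) $S_1,\ldots,S_k$ and matrices $Z^1,\ldots,Z^k$; let $T_i$ be the list of entries of the row vector $[g_1(\mathbf{x}),\ldots,g_m(\mathbf{x})]\times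 Z^i(\mathbf{y})$, where the parameters of $Z^i$ are renamed $\mathbf{y}$; return the descriptions of the $S_i$ and the lists $T_i$.
   Formalization: N here also counts the final radical test that stops the loop (one more than the body executions), as the bound fails otherwise (g=x, F=x, h=1). The basis claim assumes g linearly independent, as it fails for g=(x,x); for dependent g the set is shown only to span the invariants. *)

theory Defs
  imports
    "HOL-Library.Poly_Mapping"
    "HOL-Library.While_Combinator"
    "HOL-Computational_Algebra.Fraction_Field"
    "HOL-Algebra.Ideal"
    "Jordan_Normal_Form.Determinant"
    "Jordan_Normal_Form.DL_Submatrix"
    "Jordan_Normal_Form.Gauss_Jordan_Elimination"
begin

section \<open>Polynomials and rational functions\<close>

text \<open>
  Variables are numbered from 0, and the polynomials in \<open>x_1, ..., x_n\<close> are those using only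
  the variables \<open>0, ..., n - 1\<close>. Points of affine \<open>n\<close>-space are vectors of dimension \<open>n\<close>, and
  a polynomial map is the list of its components.
\<close>

type_synonym 'a mpoly = "(nat \<Rightarrow>\<^sub>0 nat) \<Rightarrow>\<^sub>0 'a"

definition Const :: "'a::zero \<Rightarrow> 'a mpoly" where
  "Const c = Poly_Mapping.single 0 c"

definition Var :: "nat \<Rightarrow> 'a::{zero,one} mpoly" where
  "Var i = Poly_Mapping.single (Poly_Mapping.single i 1) 1"

definition mpolys :: "nat \<Rightarrow> 'a::zero mpoly set" where
  "mpolys n = {p. \<forall>mon\<in>Poly_Mapping.keys p. Poly_Mapping.keys mon \<subseteq> {..<n}}"

definition mpoly_ring :: "nat \<Rightarrow> ('a::comm_ring_1 mpoly) ring" where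
  "mpoly_ring n = \<lparr>carrier = mpolys n, monoid.mult = (*), one = 1, zero = 0, add = (+)\<rparr>"

definition meval :: "('a::zero \<Rightarrow> 'b::comm_semiring_1) \<Rightarrow> (nat \<Rightarrow> 'b) \<Rightarrow> 'a mpoly \<Rightarrow> 'b" where
  "meval \<phi> v p = (\<Sum>mon\<in>Poly_Mapping.keys p. \<phi> (Poly_Mapping.lookup p mon) * (\<Prod>i\<in>Poly_Mapping.keys mon. v i ^ Poly_Mapping.lookup mon i))"

text \<open>Evaluation at a complex point of a polynomial with complex, resp. rational, coefficients.\<close>

definition ceval :: "complex vec \<Rightarrow> complex mpoly \<Rightarrow> complex" where
  "ceval a p = meval (\<lambda>c. c) (\<lambda>i. a $ i) p"

definition qeval :: "complex vec \<Rightarrow> rat mpoly \<Rightarrow> complex" where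
  "qeval a p = meval of_rat (\<lambda>i. a $ i) p"

definition complexify :: "rat mpoly \<Rightarrow> complex mpoly" where
  "complexify p = Poly_Mapping.map of_rat p"

text \<open>The composition \<open>p \<circ> G\<close> of a polynomial with a polynomial map.\<close>

definition mcomp :: "'a::comm_ring_1 mpoly \<Rightarrow> 'a mpoly list \<Rightarrow> 'a mpoly" where
  "mcomp p G = meval Const (\<lambda>i. G ! i) p"

definition to_frac :: "'a::idom \<Rightarrow> 'a fract" where
  "to_frac p = Fraction_Field.Fract p 1"

text \<open>
  \<open>represents n f p q\<close>: the rational function \<open>f\<close> in \<open>n\<close> variables is the fraction \<open>p / q\<close>. The
  value of \<open>f\<close> at \<open>a\<close> is computed from any such fraction with \<open>q(a) \<noteq> 0\<close>; if there is none, \<open>f\<close>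
  is not defined at \<open>a\<close> and \<open>rf_eval a f\<close> is meaningless.
\<close>

definition represents :: "nat \<Rightarrow> rat mpoly fract \<Rightarrow> rat mpoly \<Rightarrow> rat mpoly \<Rightarrow> bool" where
  "represents n f p q \<longleftrightarrow> p \<in> mpolys n \<and> q \<in> mpolys n \<and> q \<noteq> 0 \<and> f = Fraction_Field.Fract p q"

definition rat_funs :: "nat \<Rightarrow> rat mpoly fract set" where
  "rat_funs n = {f. \<exists>p q. represents n f p q}"

definition rf_defined :: "complex vec \<Rightarrow> rat mpoly fract \<Rightarrow> bool" where
  "rf_defined a f \<longleftrightarrow> (\<exists>p q. represents (dim_vec a) f p q \<and> qeval a q \<noteq> 0)"

definition rf_eval :: "complex vec \<Rightarrow> rat mpoly fract \<Rightarrow> complex" where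
  "rf_eval a f = (THE v. \<exists>p q. represents (dim_vec a) f p q \<and> qeval a q \<noteq> 0
     \<and> v = qeval a p / qeval a q)"

text \<open>
  Elements \<open>f(x, y)\<close> of \<open>Q(y)[x]\<close> (contained in \<open>C(y)[x]\<close>) are polynomials in \<open>x\<close> whose
  coefficients are rational functions of \<open>y\<close>; \<open>specialize a f\<close> is \<open>f(x, a)\<close>.
\<close>

definition specialize :: "complex vec \<Rightarrow> rat mpoly fract mpoly \<Rightarrow> complex mpoly" where
  "specialize a f = Poly_Mapping.map (rf_eval a) f"

definition lift_coeffs :: "rat mpoly \<Rightarrow> rat mpoly fract mpoly" where
  "lift_coeffs p = Poly_Mapping.map (\<lambda>c. to_frac (Const c)) p"


section \<open>Vector spaces of polynomials\<close>

definition mpoly_scale :: "'a::comm_ring_1 \<Rightarrow> 'a mpoly \<Rightarrow> 'a mpoly" where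
  "mpoly_scale c p = Const c * p"

global_interpretation mpoly: vector_space "mpoly_scale :: 'a::field \<Rightarrow> 'a mpoly \<Rightarrow> 'a mpoly"
proof
  fix a b :: 'a and p q :: "'a mpoly"
  show "mpoly_scale a (p + q) = mpoly_scale a p + mpoly_scale a q"
    by (simp add: mpoly_scale_def distrib_left)
  show "mpoly_scale (a + b) p = mpoly_scale a p + mpoly_scale b p"
    by (simp add: mpoly_scale_def Const_def single_add distrib_right)
  show "mpoly_scale a (mpoly_scale b p) = mpoly_scale (a * b) p"
    by (simp add: mpoly_scale_def Const_def mult_single mult.assoc [symmetric])
  show "mpoly_scale 1 p = p"
    by (simp add: mpoly_scale_def Const_def)
qed

definition is_basis :: "complex mpoly set \<Rightarrow> complex mpoly set \<Rightarrow> bool" where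
  "is_basis B V \<longleftrightarrow> mpoly.independent B \<and> mpoly.span B = V"

definition spanned_by :: "rat mpoly list \<Rightarrow> complex mpoly set" where
  "spanned_by gs = mpoly.span (complexify ` set gs)"

text \<open>
  Linear independence of the tuple \<open>gs\<close>, so that it is a basis of \<open>spanned_by gs\<close>. For dependent
  tuples a column of the kernel matrix may encode a linear relation between the \<open>g_j\<close>, and the
  polynomials computed from it then span the space of invariants without being independent.
\<close>

definition lin_indep :: "rat mpoly list \<Rightarrow> bool" where
  "lin_indep gs \<longleftrightarrow> distinct gs \<and> mpoly.independent (complexify ` set gs)"


section \<open>Polynomial loops and their invariants\<close>

definition apply_map :: "rat mpoly list \<Rightarrow> complex vec \<Rightarrow> complex vec" where
  "apply_map F a = vec (length F) (\<lambda>i. qeval a (F ! i))"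

definition poly_invariant ::
  "complex vec \<Rightarrow> rat mpoly list \<Rightarrow> rat mpoly list \<Rightarrow> complex mpoly \<Rightarrow> bool" where
  "poly_invariant a hs F g \<longleftrightarrow>
     (\<forall>l. (\<forall>j<l. \<forall>h\<in>set hs. qeval ((apply_map F ^^ j) a) h \<noteq> 0)
        \<longrightarrow> ceval ((apply_map F ^^ l) a) g = 0)"

definition invariants_in ::
  "complex vec \<Rightarrow> rat mpoly list \<Rightarrow> rat mpoly list \<Rightarrow> complex mpoly set \<Rightarrow> complex mpoly set" where
  "invariants_in a hs F E = {g \<in> E. poly_invariant a hs F g}"


section \<open>Algorithm InvariantSet\<close>

definition ideal_radical :: "('a, 'b) ring_scheme \<Rightarrow> 'a set \<Rightarrow> 'a set" where
  "ideal_radical R I = {p \<in> carrier R. \<exists>e::nat. p [^]\<^bsub>R\<^esub> e \<in> I}"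

text \<open>
  The state is the pair of \<open>S\<close>, in order of insertion, and the current sequence. All polynomials
  live in the ring in as many variables as the map \<open>G\<close> has components.
\<close>

type_synonym is_state = "rat mpoly list list \<times> rat mpoly list"

definition is_init :: "rat mpoly list \<Rightarrow> rat mpoly list \<Rightarrow> is_state" where
  "is_init ps G = ([ps], map (\<lambda>p. mcomp p G) ps)"

definition is_test :: "rat mpoly list \<Rightarrow> is_state \<Rightarrow> bool" where
  "is_test G = (\<lambda>(S, qs). \<not> set qs \<subseteq> ideal_radical (mpoly_ring (length G))
     (genideal (mpoly_ring (length G)) (\<Union>ps\<in>set S. set ps)))"

definition is_step :: "rat mpoly list \<Rightarrow> is_state \<Rightarrow> is_state" where
  "is_step G = (\<lambda>(S, qs). (S @ [qs], map (\<lambda>q. mcomp q G) qs))"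

text \<open>The result is \<open>None\<close> if the while loop does not terminate.\<close>

definition InvariantSet :: "rat mpoly list \<Rightarrow> rat mpoly list \<Rightarrow> rat mpoly list list option" where
  "InvariantSet ps G = map_option fst (while_option (is_test G) (is_step G) (is_init ps G))"

text \<open>
  An iteration is a pass through the head of the while loop, that is, a radical membership test:
  the final pass, in which the test makes the loop stop, is counted. (If only the executions of
  the body were counted, the bound on the number of cells would be false: for
  \<open>n = m = 1\<close>, \<open>g = x\<close>, \<open>F = x\<close>, \<open>h = 1\<close> the body is never executed, while the two cells
  \<open>x = 0\<close> and \<open>x \<noteq> 0\<close> are needed.)
\<close>

definition InvariantSet_iterations :: "rat mpoly list \<Rightarrow> rat mpoly list \<Rightarrow> nat" where
  "InvariantSet_iterations ps G =
     Suc (LEAST k. \<not> is_test G ((is_step G ^^ k) (is_init ps G)))"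


section \<open>Algorithm ComputeMatrix\<close>

text \<open>
  With \<open>n = length F\<close> and \<open>m = length gs\<close>, the variables \<open>u_1, ..., u_m\<close> are numbered
  \<open>n, ..., n + m - 1\<close>, and \<open>z\<close> has number \<open>n + m\<close>.
\<close>

definition cm_input :: "rat mpoly list \<Rightarrow> rat mpoly list \<Rightarrow> rat mpoly list" where
  "cm_input gs F = (let n = length F; m = length gs in
     [Var (n + m) * (\<Sum>j<m. Var (n + j) * gs ! j)])"

definition cm_map ::
  "rat mpoly list \<Rightarrow> rat mpoly list \<Rightarrow> rat mpoly list \<Rightarrow> rat mpoly list" where
  "cm_map gs hs F = (let n = length F; m = length gs in
     F @ map Var [n..<n + m] @ [Var (n + m) * prod_list hs])"

definition set_z_to_1 :: "nat \<Rightarrow> rat mpoly \<Rightarrow> rat mpoly" where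
  "set_z_to_1 iz p = meval Const (\<lambda>i. if i = iz then 1 else Var i) p"

definition ComputeMatrix ::
  "rat mpoly list \<Rightarrow> rat mpoly list \<Rightarrow> rat mpoly list \<Rightarrow> rat mpoly mat option" where
  "ComputeMatrix gs hs F = (let n = length F; m = length gs in
     map_option (\<lambda>S. let Ps = map (set_z_to_1 (n + m)) (concat S) in
         THE A. A \<in> carrier_mat (length Ps) m \<and> elements_mat A \<subseteq> mpolys n \<and>
           vec_of_list Ps = A *\<^sub>v vec m (\<lambda>j. Var (n + j)))
       (InvariantSet (cm_input gs F) (cm_map gs hs F)))"


section \<open>Algorithm ParametricSol\<close>

text \<open>Equations and inequations describing a constructible set.\<close>

type_synonym description = "rat mpoly list \<times> rat mpoly list"

definition constructible :: "nat \<Rightarrow> description \<Rightarrow> complex vec set" where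
  "constructible n D = {a \<in> carrier_vec n.
     (\<forall>p\<in>set (fst D). qeval a p = 0) \<and> (\<forall>q\<in>set (snd D). qeval a q \<noteq> 0)}"

text \<open>The \<open>t\<close>-element subsets of \<open>{0..<r}\<close>, each listed once.\<close>

definition index_sets :: "nat \<Rightarrow> nat \<Rightarrow> nat set list" where
  "index_sets r t = filter (\<lambda>I. card I = t) (map set (subseqs [0..<r]))"

definition minors :: "nat \<Rightarrow> 'a::comm_ring_1 mat \<Rightarrow> 'a list" where
  "minors t A = [det (submatrix A I J).
     I \<leftarrow> index_sets (dim_row A) t, J \<leftarrow> index_sets (dim_col A) t]"

text \<open>
  The permutation of the columns lists the pivot columns \<open>J\<close> first and then the others, both in
  increasing order; row \<open>j\<close> of the result is the row of the stacked matrix whose position is that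
  of \<open>j\<close> in this list.
\<close>

definition kernel_matrix :: "rat mpoly mat \<Rightarrow> nat set \<Rightarrow> nat set \<Rightarrow> rat mpoly fract mat" where
  "kernel_matrix A I J = (let
     m = dim_col A;
     B = map_mat to_frac A;
     M = submatrix B I J;
     M' = submatrix B I (- J);
     W = (- (the (mat_inverse M) * M')) @\<^sub>r 1\<^sub>m (m - card J);
     perm = sorted_list_of_set J @ sorted_list_of_set ({0..<m} - J)
   in mat m (m - card J) (\<lambda>(j, l). W $$ ((THE q. q < m \<and> perm ! q = j), l)))"

definition ParametricSol :: "rat mpoly mat \<Rightarrow> (description \<times> rat mpoly fract mat) list" where
  "ParametricSol A =
     [((minors (t + 1) A, [det (submatrix A I J)]), kernel_matrix A I J).
       t \<leftarrow> [0..<Suc (min (dim_row A) (dim_col A))],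
       I \<leftarrow> index_sets (dim_row A) t,
       J \<leftarrow> index_sets (dim_col A) t,
       det (submatrix (map_mat to_frac A) I J) \<noteq> 0]"


section \<open>Algorithm TruncatedClass\<close>

definition row_times :: "rat mpoly list \<Rightarrow> rat mpoly fract mat \<Rightarrow> rat mpoly fract mpoly list" where
  "row_times gs Z =
     list_of_vec (row (mat_of_row (vec_of_list (map lift_coeffs gs)) * map_mat Const Z) 0)"

definition TruncatedClass ::
  "rat mpoly list \<Rightarrow> rat mpoly list \<Rightarrow> rat mpoly list
    \<Rightarrow> (description \<times> rat mpoly fract mpoly list) list option" where
  "TruncatedClass gs hs F =
     map_option (\<lambda>A. map (\<lambda>(D, Z). (D, row_times gs Z)) (ParametricSol A))
       (ComputeMatrix gs hs F)"

end

theory Submission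
  imports Defs
begin

text \<open>
  The row \<open>l\<close> of the matrix computed from \<open>g\<close>, evaluated at \<open>a\<close>, is the vector of the values
  \<open>g_j(F^l(a))\<close> multiplied by the product of the guards met before step \<open>l\<close>. Hence a combination
  of the \<open>g_j\<close> is an invariant iff its coefficient vector is annihilated by all these rows,
  \<open>l = 0, 1, ...\<close>. The loop of InvariantSet stops because ideals of polynomials satisfy the
  ascending chain condition, and once it stops the common zero set of the rows found so far is
  stable under the extended map, so that all further rows vanish on it as well. The invariants
  are therefore the kernel of a finite matrix \<open>A(a)\<close>. On the cell where the minor \<open>det M\<close> does
  not vanish and all larger minors do, the rows outside \<open>M\<close> are combinations of those through
  \<open>M\<close>, and Cramer's rule parametrizes the kernel. The cells are indexed by pairs of a row set and
  a column set of equal size, which Vandermonde's identity counts.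
\<close>

section \<open>Multivariate polynomials and their evaluation\<close>

text \<open>The coefficients u_j and the factor z are extra state variables: the extended map fixes
  the u_j and lets z absorb the guards. One run of InvariantSet thus serves all starting points and
  all combinations of the g_j: coefficients b at a starting point a form the point (a, b, 1), and z
  becomes 0 and stays 0 once a guard fails. Membership is tested over the rationals while points are
  complex; a polynomial with a power in the ideal vanishes at every common zero, whatever field its
  coordinates lie in. The obstacle on a cell is that the kernel matrix lives over the rational
  functions, whose values exist only away from their poles. So Cramer's rule is kept in the form
  numerator over \<open>det M\<close>, with polynomial numerators built from the adjugate: these
  commute both with evaluation and with the embedding into fractions, and the only denominator is
  the polynomial that is nonzero on the cell.\<close>

lemma poly_mapping_sum_single: "p = (\<Sum>a\<in>Poly_Mapping.keys p. Poly_Mapping.single a (Poly_Mapping.lookup p a))"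
  by (rule poly_mapping_eqI) (simp add: lookup_sum lookup_single when_def sum.delta in_keys_iff)

definition monom_eval :: "(nat \<Rightarrow> 'b::comm_semiring_1) \<Rightarrow> (nat \<Rightarrow>\<^sub>0 nat) \<Rightarrow> 'b" where
  "monom_eval v mn = (\<Prod>i\<in>Poly_Mapping.keys mn. v i ^ Poly_Mapping.lookup mn i)"

lemma monom_eval_superset:
  "finite A \<Longrightarrow> Poly_Mapping.keys mn \<subseteq> A \<Longrightarrow> monom_eval v mn = (\<Prod>i\<in>A. v i ^ Poly_Mapping.lookup mn i)"
  unfolding monom_eval_def by (rule prod.mono_neutral_left) (auto simp: in_keys_iff)

lemma monom_eval_0 [simp]: "monom_eval v 0 = 1"
  by (simp add: monom_eval_def)

lemma monom_eval_add: "monom_eval v (a + b) = monom_eval v a * monom_eval v b"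
proof -
  let ?A = "Poly_Mapping.keys a \<union> Poly_Mapping.keys b"
  have "Poly_Mapping.keys (a + b) \<subseteq> ?A" by (rule Poly_Mapping.keys_add)
  then show ?thesis
    by (simp add: monom_eval_superset[of ?A] lookup_add power_add prod.distrib)
qed

text \<open>Addition may cancel monomials, so p, q and p + q have different supports. Summing over a
  common finite superset makes additivity a termwise identity; the condition on
  \<open>\<phi> 0\<close> makes the extra terms vanish.\<close>

lemma meval_superset:
  assumes "\<phi> 0 = 0" "finite A" "Poly_Mapping.keys p \<subseteq> A"
  shows "meval \<phi> v p = (\<Sum>a\<in>A. \<phi> (Poly_Mapping.lookup p a) * monom_eval v a)"
  unfolding meval_def monom_eval_def [symmetric]
  by (rule sum.mono_neutral_left) (use assms in \<open>auto simp: in_keys_iff\<close>)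

context comm_ring_hom
begin

lemma meval_single: "meval hom v (Poly_Mapping.single a c) = hom c * monom_eval v a"
  by (subst meval_superset[of _ "{a}"]) auto

lemma meval_add: "meval hom v (p + q) = meval hom v p + meval hom v q"
proof -
  let ?A = "Poly_Mapping.keys p \<union> Poly_Mapping.keys q"
  have "Poly_Mapping.keys (p + q) \<subseteq> ?A" by (rule Poly_Mapping.keys_add)
  then show ?thesis
    by (simp add: meval_superset[of _ ?A] lookup_add hom_add distrib_right sum.distrib)
qed

lemma meval_0: "meval hom v 0 = 0"
  by (simp add: meval_def)

lemma meval_sum: "meval hom v (sum f A) = (\<Sum>x\<in>A. meval hom v (f x))"
  by (induction A rule: infinite_finite_induct) (auto simp: meval_0 meval_add)

lemma meval_mult: "meval hom v (p * q) = meval hom v p * meval hom v q"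
proof -
  have "p * q = (\<Sum>a\<in>Poly_Mapping.keys p. \<Sum>b\<in>Poly_Mapping.keys q.
      Poly_Mapping.single (a + b) (Poly_Mapping.lookup p a * Poly_Mapping.lookup q b))"
    by (subst poly_mapping_sum_single[of p], subst poly_mapping_sum_single[of q])
      (simp add: sum_product mult_single)
  also have "meval hom v \<dots> = meval hom v p * meval hom v q"
    by (simp add: meval_sum meval_single meval_superset[OF _ _ order_refl] sum_product hom_mult
        monom_eval_add mult_ac)
  finally show ?thesis .
qed

lemma comm_ring_hom_meval: "comm_ring_hom (meval hom v)"
proof
  show "meval hom v 1 = 1"
    by (simp add: meval_single flip: single_one)
qed (simp_all add: meval_0 meval_add meval_mult)

lemma meval_Const: "meval hom v (Const c) = hom c"
  by (simp add: Const_def meval_single)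

lemma meval_Var: "meval hom v (Var i) = v i"
  by (simp add: Var_def meval_single monom_eval_def)

end

interpretation Const_hom: comm_ring_hom "Const :: 'a::comm_ring_1 \<Rightarrow> 'a mpoly"
  by unfold_locales (simp_all add: Const_def single_add mult_single)

lemma id_comm_ring_hom: "comm_ring_hom (\<lambda>c. c)"
  by unfold_locales auto

lemma of_rat_comm_ring_hom: "comm_ring_hom (of_rat :: rat \<Rightarrow> 'a::field_char_0)"
  by unfold_locales (simp_all add: of_rat_add of_rat_mult)

text \<open>The substitution lemma: evaluation is a ring homomorphism, so it passes through the sums
  and products that form \<open>meval Const g p\<close>. It turns composition of polynomials into
  composition of maps.\<close>

lemma meval_comp:
  assumes "comm_ring_hom \<phi>"
  shows "meval \<phi> v (meval Const g p) = meval \<phi> (\<lambda>i. meval \<phi> v (g i)) p"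
proof -
  interpret \<phi>: comm_ring_hom \<phi> by fact
  interpret ev: comm_ring_hom "meval \<phi> v" by (rule \<phi>.comm_ring_hom_meval)
  show ?thesis
    by (subst (2 3) meval_def) (simp add: ev.hom_sum ev.hom_mult ev.hom_prod ev.hom_power \<phi>.meval_Const)
qed

lemma Var_power: "Var i ^ k = (Poly_Mapping.single (Poly_Mapping.single i k) 1 :: 'a::comm_ring_1 mpoly)"
  by (induction k) (auto simp: Var_def mult_single simp flip: single_add)

lemma prod_single: "(\<Prod>i\<in>A. Poly_Mapping.single (f i) (1::'a::comm_ring_1)) = Poly_Mapping.single (sum f A) 1"
  for f :: "'b \<Rightarrow> 'c::comm_monoid_add"
  by (induction A rule: infinite_finite_induct) (auto simp: mult_single)

lemma meval_Const_Var: "meval Const Var p = (p :: 'a::comm_ring_1 mpoly)"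
proof -
  have "meval Const Var p = (\<Sum>a\<in>Poly_Mapping.keys p. Const (Poly_Mapping.lookup p a) *
      (\<Prod>i\<in>Poly_Mapping.keys a. Poly_Mapping.single (Poly_Mapping.single i (Poly_Mapping.lookup a i)) 1))"
    by (simp add: meval_def Var_power)
  also have "\<dots> = (\<Sum>a\<in>Poly_Mapping.keys p. Poly_Mapping.single a (Poly_Mapping.lookup p a))"
    by (simp add: prod_single Const_def mult_single flip: poly_mapping_sum_single)
  finally show ?thesis by (simp flip: poly_mapping_sum_single)
qed

lemma meval_cong:
  assumes "p \<in> mpolys n" "\<And>i. i < n \<Longrightarrow> v i = w i"
  shows "meval \<phi> v p = meval \<phi> w p"
proof -
  have "v i = w i" if "a \<in> Poly_Mapping.keys p" "i \<in> Poly_Mapping.keys a" for a i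
    using assms that by (auto simp: mpolys_def subset_iff)
  then show ?thesis unfolding meval_def by (auto intro!: sum.cong prod.cong)
qed

lemma mpolysI: "(\<And>a i. a \<in> Poly_Mapping.keys p \<Longrightarrow> i \<in> Poly_Mapping.keys a \<Longrightarrow> i < n) \<Longrightarrow> p \<in> mpolys n"
  by (auto simp: mpolys_def)

lemma mpolysD: "p \<in> mpolys n \<Longrightarrow> a \<in> Poly_Mapping.keys p \<Longrightarrow> i \<in> Poly_Mapping.keys a \<Longrightarrow> i < n"
  by (auto simp: mpolys_def)

lemma mpolys_mono: "n \<le> k \<Longrightarrow> mpolys n \<subseteq> mpolys k"
  by (fastforce simp: mpolys_def)

lemma mpolys_0 [simp]: "0 \<in> mpolys n"
  by (simp add: mpolys_def)

lemma mpolys_Const [simp]: "Const c \<in> mpolys n"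
  by (rule mpolysI) (auto simp: Const_def split: if_splits)

lemma mpolys_1 [simp]: "(1 :: 'a::comm_ring_1 mpoly) \<in> mpolys n"
  using mpolys_Const[of "1::'a" n] by simp

lemma mpolys_Var [simp]: "i < n \<Longrightarrow> (Var i :: 'a::comm_ring_1 mpoly) \<in> mpolys n"
  by (rule mpolysI) (auto simp: Var_def split: if_splits)

lemma mpolys_add [intro]: "p \<in> mpolys n \<Longrightarrow> q \<in> mpolys n \<Longrightarrow> p + q \<in> mpolys n"
  using Poly_Mapping.keys_add[of p q] by (auto simp: mpolys_def)

lemma mpolys_mult [intro]:
  assumes "p \<in> mpolys n" "q \<in> mpolys n"
  shows "p * q \<in> mpolys n"
proof (rule mpolysI)
  fix c i assume c: "c \<in> Poly_Mapping.keys (p * q)" and i: "i \<in> Poly_Mapping.keys c"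
  from c keys_mult[of p q] obtain a b where ab: "c = a + b" "a \<in> Poly_Mapping.keys p" "b \<in> Poly_Mapping.keys q"
    by auto
  from i ab Poly_Mapping.keys_add[of a b] have "i \<in> Poly_Mapping.keys a \<or> i \<in> Poly_Mapping.keys b" by auto
  with assms ab show "i < n" by (auto dest: mpolysD)
qed

lemma mpolys_uminus [intro]: "p \<in> mpolys n \<Longrightarrow> - p \<in> mpolys n" for p :: "'a::comm_ring_1 mpoly"
  using mpolys_mult[OF mpolys_Const[of "-1"], of p n] by (simp add: Const_hom.hom_uminus del: mpolys_Const)

lemma mpolys_sum: "(\<And>x. x \<in> A \<Longrightarrow> f x \<in> mpolys n) \<Longrightarrow> sum f A \<in> mpolys n"
  by (induction A rule: infinite_finite_induct) auto

lemma mpolys_prod: "(\<And>x. x \<in> A \<Longrightarrow> f x \<in> mpolys n) \<Longrightarrow> prod f A \<in> mpolys n"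
  for f :: "_ \<Rightarrow> 'a::comm_ring_1 mpoly"
  by (induction A rule: infinite_finite_induct) auto

lemma mpolys_power: "p \<in> mpolys n \<Longrightarrow> p ^ k \<in> mpolys n" for p :: "'a::comm_ring_1 mpoly"
  by (induction k) auto

lemma mpolys_prod_list: "set ps \<subseteq> mpolys n \<Longrightarrow> prod_list ps \<in> mpolys n" for ps :: "'a::comm_ring_1 mpoly list"
  by (induction ps) auto

lemma mpolys_det:
  fixes A :: "'a::comm_ring_1 mpoly mat"
  assumes "\<And>i j. i < dim_row A \<Longrightarrow> j < dim_col A \<Longrightarrow> A $$ (i, j) \<in> mpolys n"
  shows "det A \<in> mpolys n"
proof (cases "dim_row A = dim_col A")
  case True
  have s: "signof p * q \<in> mpolys n" if "q \<in> mpolys n" for p and q :: "'a mpoly"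
    using that by (auto simp: sign_def)
  have "(\<Prod>i = 0..<dim_row A. A $$ (i, p i)) \<in> mpolys n" if "p permutes {0..<dim_row A}" for p
  proof (rule mpolys_prod, rule assms)
    fix i assume "i \<in> {0..<dim_row A}"
    with permutes_in_image[OF that, of i] True show "i < dim_row A" "p i < dim_col A" by auto
  qed
  with s show ?thesis unfolding det_def by (auto intro!: mpolys_sum)
qed (simp add: det_def)

lemma mpolys_meval_Const:
  fixes g :: "nat \<Rightarrow> 'a::comm_ring_1 mpoly"
  assumes "p \<in> mpolys n" "\<And>i. i < n \<Longrightarrow> g i \<in> mpolys k"
  shows "meval Const g p \<in> mpolys k"
  unfolding meval_def
  by (intro mpolys_sum mpolys_mult mpolys_prod mpolys_power mpolys_Const assms(2))
     (use assms(1) in \<open>auto dest: mpolysD\<close>)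

lemma mpolys_mcomp:
  "p \<in> mpolys (length G) \<Longrightarrow> set G \<subseteq> mpolys k \<Longrightarrow> mcomp p G \<in> mpolys k"
  unfolding mcomp_def by (rule mpolys_meval_Const) auto


section \<open>The ascending chain condition for polynomial ideals\<close>

lemma monom_factor_of_le:
  fixes a b :: "nat \<Rightarrow>\<^sub>0 nat"
  assumes "\<And>i. Poly_Mapping.lookup a i \<le> Poly_Mapping.lookup b i"
  shows "\<exists>d. b = a + d \<and> Poly_Mapping.keys d \<subseteq> Poly_Mapping.keys b"
proof -
  have "b = a + (b - a)"
    by (rule poly_mapping_eqI) (simp add: lookup_add lookup_minus assms)
  moreover have "Poly_Mapping.keys (b - a) \<subseteq> Poly_Mapping.keys b"
    by (auto simp: in_keys_iff lookup_minus)
  ultimately show ?thesis by blast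
qed

text \<open>The order on exponent vectors is lexicographic: the smallest index with different
  exponents decides. Adding d raises the exponent at the least index in its support and leaves all
  earlier ones alone.\<close>

lemma add_ge_monomial: "a \<le> a + d" for a d :: "nat \<Rightarrow>\<^sub>0 nat"
proof (cases "d = 0")
  case False
  then have ne: "Poly_Mapping.keys d \<noteq> {}" by simp
  define k where "k = Min (Poly_Mapping.keys d)"
  have k: "k \<in> Poly_Mapping.keys d" unfolding k_def using ne by (intro Min_in) auto
  have "Poly_Mapping.lookup d j = 0" if "j < k" for j
    using that ne unfolding k_def by (metis Min_le finite_keys in_keys_iff leD)
  then have "a < a + d"
    using k unfolding less_poly_mapping.rep_eq less_fun_def
    by (intro exI[of _ k]) (auto simp: lookup_add in_keys_iff)
  then show ?thesis by simp
qed auto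

text \<open>The sequence is thinned out one coordinate at a time; coordinates already treated are
  not disturbed, because a subsequence of a weakly increasing sequence is weakly increasing.\<close>

lemma dickson_subseq:
  fixes f :: "nat \<Rightarrow> nat \<Rightarrow> nat"
  shows "\<exists>r. strict_mono r \<and> (\<forall>i<n. incseq (\<lambda>k. f (r k) i))"
proof (induction n)
  case 0
  then show ?case by (intro exI[of _ id]) (auto simp: strict_mono_def)
next
  case (Suc n)
  then obtain r where r: "strict_mono r" "\<And>i. i < n \<Longrightarrow> incseq (\<lambda>k. f (r k) i)" by blast
  define h where "h k = f (r k) n" for k
  have "\<exists>s. strict_mono s \<and> incseq (\<lambda>k. h (s k))"
  proof -
    obtain s where s: "strict_mono s" "monoseq (\<lambda>k. h (s k))"
      using seq_monosub[of h] by (auto simp: o_def)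
    from s(2) consider "incseq (\<lambda>k. h (s k))" | "decseq (\<lambda>k. h (s k))"
      by (auto simp: monoseq_iff)
    then show ?thesis
    proof cases
      case 2
      \<comment> \<open>A weakly decreasing sequence of naturals is constant from any place where
        its least value \<open>m\<close> is attained, so the tail from \<open>k0\<close> on is also
        weakly increasing.\<close>
      define m where "m = (LEAST m. \<exists>k. h (s k) = m)"
      have "\<exists>k. h (s k) = m" unfolding m_def by (rule LeastI_ex) blast
      then obtain k0 where k0: "h (s k0) = m" by blast
      have low: "m \<le> h (s k)" for k unfolding m_def by (rule Least_le) blast
      have "h (s (k0 + k)) = m" for k
        using 2 low[of "k0 + k"] k0 by (metis antisym decseqD le_add1)
      moreover have "strict_mono (\<lambda>k. s (k0 + k))"
        using s(1) by (auto simp: strict_mono_def)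
      ultimately show ?thesis by (intro exI[of _ "\<lambda>k. s (k0 + k)"]) (auto simp: incseq_def)
    qed (use s in blast)
  qed
  then obtain s where s: "strict_mono s" "incseq (\<lambda>k. h (s k))" by blast
  have "incseq (\<lambda>k. f (r (s k)) i)" if "i < Suc n" for i
  proof (cases "i = n")
    case True then show ?thesis using s(2) by (simp add: h_def)
  next
    case False
    with that r(2)[of i] s(1) show ?thesis
      by (auto simp: incseq_def strict_mono_less_eq)
  qed
  moreover have "strict_mono (\<lambda>k. r (s k))" using r(1) s(1) by (auto simp: strict_mono_def)
  ultimately show ?case by blast
qed

lemma dickson:
  fixes f :: "nat \<Rightarrow> (nat \<Rightarrow>\<^sub>0 nat)"
  assumes "\<And>k. Poly_Mapping.keys (f k) \<subseteq> {..<n}"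
  obtains i j d where "i < j" "f j = f i + d" "Poly_Mapping.keys d \<subseteq> {..<n}"
proof -
  obtain r where r: "strict_mono r" "\<And>i. i < n \<Longrightarrow> incseq (\<lambda>k. Poly_Mapping.lookup (f (r k)) i)"
    using dickson_subseq[of n "\<lambda>k. Poly_Mapping.lookup (f k)"] by blast
  have "Poly_Mapping.lookup (f (r 0)) i \<le> Poly_Mapping.lookup (f (r 1)) i" for i
  proof (cases "i < n")
    case True with r(2) show ?thesis by (simp add: incseq_def)
  next
    case False
    with assms[of "r 0"] have "Poly_Mapping.lookup (f (r 0)) i = 0"
      by (metis in_keys_iff lessThan_iff subsetD)
    then show ?thesis by simp
  qed
  then obtain d where "f (r 1) = f (r 0) + d" "Poly_Mapping.keys d \<subseteq> Poly_Mapping.keys (f (r 1))"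
    using monom_factor_of_le by blast
  moreover have "r 0 < r 1" using r(1) by (auto simp: strict_mono_def)
  ultimately show ?thesis using assms[of "r 1"] by (intro that[of "r 0" "r 1" d]) auto
qed

section \<open>Leading monomials and ascending chains\<close>

definition lead_monom :: "'a::zero mpoly \<Rightarrow> (nat \<Rightarrow>\<^sub>0 nat)" where
  "lead_monom p = Max (Poly_Mapping.keys p)"

lemma lead_monom_in_keys: "p \<noteq> 0 \<Longrightarrow> lead_monom p \<in> Poly_Mapping.keys p"
  unfolding lead_monom_def by (rule Max_in) auto

lemma lift_Suc_antimono_less:
  fixes f :: "nat \<Rightarrow> 'a::order"
  assumes "\<And>k. f (Suc k) < f k" "i < j"
  shows "f j < f i"
  using assms(2) by (induction j) (use assms(1) in \<open>auto simp: less_Suc_eq intro: less_trans\<close>)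

text \<open>Restricted to n variables, because the lexicographic order on all monomials is not
  well-founded: the exponent vectors of \<open>Var 0\<close>, \<open>Var 1\<close>,
  \<open>Var 2\<close>, ... descend forever.\<close>

definition monom_less :: "nat \<Rightarrow> ((nat \<Rightarrow>\<^sub>0 nat) \<times> (nat \<Rightarrow>\<^sub>0 nat)) set" where
  "monom_less n = {(a, b). a < b \<and> Poly_Mapping.keys a \<subseteq> {..<n} \<and> Poly_Mapping.keys b \<subseteq> {..<n}}"

text \<open>In an infinite descending chain Dickson's lemma finds a member dividing a later one, but
  a divisor is never larger than its multiple.\<close>

lemma wf_monom_less: "wf (monom_less n)"
proof (rule ccontr)
  assume "\<not> ?thesis"
  then obtain f :: "nat \<Rightarrow> (nat \<Rightarrow>\<^sub>0 nat)" where "\<forall>k. (f (Suc k), f k) \<in> monom_less n"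
    unfolding wf_iff_no_infinite_down_chain by blast
  then have f: "\<And>k. f (Suc k) < f k" "\<And>k. Poly_Mapping.keys (f k) \<subseteq> {..<n}"
    by (auto simp: monom_less_def)
  obtain i j d where "i < j" "f j = f i + d"
    by (rule dickson[OF f(2)])
  moreover have "f j < f i"
    using f(1) \<open>i < j\<close> by (rule lift_Suc_antimono_less)
  ultimately show False using add_ge_monomial[of "f i" d] by simp
qed

lemma lookup_single_mult:
  fixes d a :: "nat \<Rightarrow>\<^sub>0 nat" and q :: "'a::comm_ring_1 mpoly"
  shows "Poly_Mapping.lookup (Poly_Mapping.single d c * q) (d + a) = c * Poly_Mapping.lookup q a"
proof -
  have "Poly_Mapping.single d c * q =
      (\<Sum>b\<in>Poly_Mapping.keys q. Poly_Mapping.single (d + b) (c * Poly_Mapping.lookup q b))"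
    by (subst poly_mapping_sum_single[of q]) (simp add: sum_distrib_left mult_single)
  then show ?thesis
    by (simp add: lookup_sum lookup_single when_def in_keys_iff)
qed

text \<open>
  A strictly ascending chain of ideals would, by choosing elements of minimal leading monomial in
  the successive differences, yield a sequence of monomials none of which divides a later one.
\<close>
lemma ideals_stabilize:
  fixes I :: "nat \<Rightarrow> 'a::field mpoly set"
  assumes sub: "\<And>k. I k \<subseteq> mpolys n"
    and zero: "\<And>k. 0 \<in> I k"
    and diff: "\<And>k p q. p \<in> I k \<Longrightarrow> q \<in> I k \<Longrightarrow> p - q \<in> I k"
    and mult: "\<And>k p q. p \<in> I k \<Longrightarrow> q \<in> mpolys n \<Longrightarrow> q * p \<in> I k"
    and mono: "\<And>k. I k \<subseteq> I (Suc k)"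
  shows "\<exists>k. I (Suc k) = I k"
proof (rule ccontr)
  assume "\<not> ?thesis"
  with mono have ne: "I (Suc k) - I k \<noteq> {}" for k by blast
  have "\<exists>q. q \<in> I (Suc k) - I k \<and> (\<forall>p. (lead_monom p, lead_monom q) \<in> monom_less n \<longrightarrow> p \<notin> I (Suc k) - I k)" for k
  proof -
    have "wf (inv_image (monom_less n) lead_monom)" using wf_monom_less by (rule wf_inv_image)
    from wfE_min'[OF this ne[of k]] show ?thesis by (auto simp: in_inv_image)
  qed
  then obtain q where q: "\<And>k. q k \<in> I (Suc k) - I k"
    and min: "\<And>k p. (lead_monom p, lead_monom (q k)) \<in> monom_less n \<Longrightarrow> p \<notin> I (Suc k) - I k"
    using choice[of "\<lambda>k q. q \<in> I (Suc k) - I k \<and> (\<forall>p. (lead_monom p, lead_monom q) \<in> monom_less n \<longrightarrow> p \<notin> I (Suc k) - I k)"]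
    by blast
  have keys: "Poly_Mapping.keys a \<subseteq> {..<n}" if "a \<in> Poly_Mapping.keys p" "p \<in> I k" for a p k
    using that sub[of k] by (auto simp: mpolys_def)
  have q0: "q k \<noteq> 0" for k using q[of k] zero[of k] by auto
  have lm: "Poly_Mapping.keys (lead_monom (q k)) \<subseteq> {..<n}" for k
    using keys[OF lead_monom_in_keys[OF q0]] q[of k] by blast
  obtain i j d where ij: "i < j" "lead_monom (q j) = lead_monom (q i) + d" "Poly_Mapping.keys d \<subseteq> {..<n}"
    by (rule dickson[of "\<lambda>k. lead_monom (q k)" n]) (use lm in auto)
  \<comment> \<open>The factor \<open>s\<close> cancels the leading term of \<open>q j\<close>. As
    \<open>i < j\<close>, the product \<open>s * q i\<close> already lies in \<open>I j\<close>, so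
    \<open>p\<close> stays in \<open>I (Suc j) - I j\<close> with a smaller leading monomial,
    against the minimality of \<open>q j\<close>.\<close>
  define c where "c = Poly_Mapping.lookup (q j) (lead_monom (q j)) / Poly_Mapping.lookup (q i) (lead_monom (q i))"
  define s where "s = Poly_Mapping.single d c"
  define p where "p = q j - s * q i"
  have inc: "incseq I" by (rule incseq_SucI) (rule mono)
  have s: "s \<in> mpolys n"
    unfolding s_def by (rule mpolysI) (use ij(3) in \<open>auto split: if_splits\<close>)
  have qi: "q i \<in> I j" using q[of i] incseqD[OF inc, of "Suc i" j] ij(1) by auto
  then have sq: "s * q i \<in> I j" using mult s by blast
  have p: "p \<in> I (Suc j) - I j"
  proof -
    have "p \<in> I (Suc j)" unfolding p_def using diff q[of j] sq mono[of j] by blast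
    moreover have "p \<notin> I j"
    proof
      assume "p \<in> I j"
      then have "p - (0 - s * q i) \<in> I j" using diff sq zero by blast
      then show False using q[of j] by (simp add: p_def)
    qed
    ultimately show ?thesis by blast
  qed
  have p0: "p \<noteq> 0" using p zero[of j] by auto
  have look: "Poly_Mapping.lookup (s * q i) (d + a) = c * Poly_Mapping.lookup (q i) a" for a
    unfolding s_def by (rule lookup_single_mult)
  have ks: "Poly_Mapping.keys (s * q i) \<subseteq> (\<lambda>a. d + a) ` Poly_Mapping.keys (q i)"
    using keys_mult[of s "q i"] by (auto simp: s_def split: if_splits)
  have "a \<le> lead_monom (q j)" if "a \<in> Poly_Mapping.keys p" for a
  proof -
    have "a \<in> Poly_Mapping.keys (q j) \<or> a \<in> Poly_Mapping.keys (s * q i)"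
      using that unfolding p_def by (auto simp: in_keys_iff lookup_minus)
    then show ?thesis
    proof
      assume "a \<in> Poly_Mapping.keys (s * q i)"
      then obtain b where b: "b \<in> Poly_Mapping.keys (q i)" "a = d + b" using ks by blast
      have "b \<le> lead_monom (q i)" unfolding lead_monom_def using b by simp
      then show ?thesis using add_left_mono[of b "lead_monom (q i)" d] b ij(2) by (simp add: add.commute)
    qed (simp add: lead_monom_def)
  qed
  moreover have "Poly_Mapping.lookup p (lead_monom (q j)) = 0"
    using lead_monom_in_keys[OF q0, of i]
    by (simp add: p_def lookup_minus ij(2) add.commute[of _ d] look c_def in_keys_iff)
  ultimately have "lead_monom p < lead_monom (q j)"
    using lead_monom_in_keys[OF p0] by (metis in_keys_iff order_le_less)
  moreover have "Poly_Mapping.keys (lead_monom p) \<subseteq> {..<n}"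
    using keys[OF lead_monom_in_keys[OF p0]] p by blast
  ultimately show False using min[of p j] p lm[of j] by (simp add: monom_less_def)
qed


section \<open>InvariantSet\<close>

lemma mpoly_ring_simps [simp]:
  "carrier (mpoly_ring n) = mpolys n" "monoid.mult (mpoly_ring n) = (*)" "monoid.one (mpoly_ring n) = 1"
  "ring.zero (mpoly_ring n) = 0" "ring.add (mpoly_ring n) = (+)"
  by (simp_all add: mpoly_ring_def)

lemma cring_mpoly_ring: "cring (mpoly_ring n :: 'a::comm_ring_1 mpoly ring)"
proof (intro cringI abelian_groupI comm_monoidI)
  fix x :: "'a mpoly" assume "x \<in> carrier (mpoly_ring n)"
  then show "\<exists>y\<in>carrier (mpoly_ring n). y \<oplus>\<^bsub>mpoly_ring n\<^esub> x = \<zero>\<^bsub>mpoly_ring n\<^esub>"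
    by (intro bexI[of _ "- x"]) auto
qed (auto simp: algebra_simps)

lemma a_inv_mpoly_ring: "p \<in> mpolys n \<Longrightarrow> a_inv (mpoly_ring n) p = - p" for p :: "'a::comm_ring_1 mpoly"
proof -
  interpret cring "mpoly_ring n :: 'a mpoly ring" by (rule cring_mpoly_ring)
  show "p \<in> mpolys n \<Longrightarrow> a_inv (mpoly_ring n) p = - p" by (rule minus_equality) auto
qed

lemma mpoly_ring_pow: "p [^]\<^bsub>mpoly_ring n\<^esub> (e::nat) = p ^ e" for p :: "'a::comm_ring_1 mpoly"
proof -
  interpret cring "mpoly_ring n :: 'a mpoly ring" by (rule cring_mpoly_ring)
  show ?thesis by (induction e) (simp_all add: mult.commute)
qed

lemma ideal_vanishing:
  fixes \<phi> :: "'a::comm_ring_1 \<Rightarrow> 'b::comm_ring_1"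
  assumes "comm_ring_hom \<phi>"
  shows "ideal {p \<in> mpolys n. meval \<phi> v p = 0} (mpoly_ring n)"
proof -
  interpret R: cring "mpoly_ring n :: 'a mpoly ring" by (rule cring_mpoly_ring)
  interpret \<phi>: comm_ring_hom \<phi> by fact
  interpret ev: comm_ring_hom "meval \<phi> v" by (rule \<phi>.comm_ring_hom_meval)
  have inv: "inv\<^bsub>\<lparr>carrier = mpolys n, monoid.mult = (+), one = 0\<rparr>\<^esub> x = - x" if "x \<in> mpolys n" for x :: "'a mpoly"
    using a_inv_mpoly_ring[OF that] by (simp add: a_inv_def)
  show ?thesis
  proof (rule idealI)
    show "subgroup {p \<in> mpolys n. meval \<phi> v p = 0} (add_monoid (mpoly_ring n))"
      by (rule subgroup.intro)
        (auto simp: ev.hom_add ev.hom_uminus inv)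
  qed (auto simp: ev.hom_mult R.ring_axioms)
qed

text \<open>Vanishing at v defines an ideal, so it passes from the generators to everything they
  generate; it passes from a power to its base because the target is a domain. The homomorphism
  \<open>\<phi>\<close> lets rational ideals be tested at complex points.\<close>

lemma radical_vanishes:
  fixes \<phi> :: "'a::comm_ring_1 \<Rightarrow> 'b::idom"
  assumes "comm_ring_hom \<phi>" "S \<subseteq> mpolys n" "\<And>s. s \<in> S \<Longrightarrow> meval \<phi> v s = 0"
    and "p \<in> ideal_radical (mpoly_ring n) (genideal (mpoly_ring n) S)"
  shows "meval \<phi> v p = 0"
proof -
  interpret R: cring "mpoly_ring n :: 'a mpoly ring" by (rule cring_mpoly_ring)
  interpret \<phi>: comm_ring_hom \<phi> by fact
  interpret ev: comm_ring_hom "meval \<phi> v" by (rule \<phi>.comm_ring_hom_meval)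
  have "genideal (mpoly_ring n) S \<subseteq> {p \<in> mpolys n. meval \<phi> v p = 0}"
    by (rule R.genideal_minimal[OF ideal_vanishing[OF assms(1)]]) (use assms(2,3) in auto)
  moreover from assms(4) obtain e :: nat where "p ^ e \<in> genideal (mpoly_ring n) S"
    by (auto simp: ideal_radical_def mpoly_ring_pow)
  ultimately have "meval \<phi> v (p ^ e) = 0" by auto
  then show ?thesis by (simp add: ev.hom_power)
qed

definition comp_all :: "rat mpoly list \<Rightarrow> rat mpoly list \<Rightarrow> rat mpoly list" where
  "comp_all G qs = map (\<lambda>q. mcomp q G) qs"

text \<open>Turns questions about the while loop into questions about iterates of
  \<open>comp_all G\<close>. The input itself is inserted at the start, so k executions of the body
  leave k + 1 collected sequences.\<close>

lemma is_state_eq: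
  "(is_step G ^^ k) (is_init ps G) = (map (\<lambda>l. (comp_all G ^^ l) ps) [0..<Suc k], (comp_all G ^^ Suc k) ps)"
  by (induction k) (simp_all add: is_init_def is_step_def comp_all_def)

lemma comp_all_mpolys:
  assumes "set ps \<subseteq> mpolys (length G)" "set G \<subseteq> mpolys (length G)"
  shows "set ((comp_all G ^^ l) ps) \<subseteq> mpolys (length G)"
  by (induction l) (use assms in \<open>auto simp: comp_all_def intro!: mpolys_mcomp\<close>)

text \<open>The ideals generated by the first k + 1 sequences ascend with k. Where two neighbours
  coincide, the pending sequence lies in the ideal itself, hence in its radical with exponent 1, and
  the test ends the loop.\<close>

lemma InvariantSet_terminates:
  assumes "set ps \<subseteq> mpolys (length G)" "set G \<subseteq> mpolys (length G)"
  shows "\<exists>k. \<not> is_test G ((is_step G ^^ k) (is_init ps G))"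
proof -
  let ?n = "length G"
  let ?R = "mpoly_ring ?n :: rat mpoly ring"
  interpret R: cring ?R by (rule cring_mpoly_ring)
  define S where "S k = (\<Union>l<Suc k. set ((comp_all G ^^ l) ps))" for k
  have S: "S k \<subseteq> carrier ?R" for k
    unfolding S_def using comp_all_mpolys[OF assms] by auto
  have I: "ideal (genideal ?R (S k)) ?R" for k
    by (rule R.genideal_ideal[OF S])
  have "\<exists>k. genideal ?R (S (Suc k)) = genideal ?R (S k)"
  proof (rule ideals_stabilize)
    fix k p q
    interpret I: ideal "genideal ?R (S k)" ?R by (rule I)
    show "genideal ?R (S k) \<subseteq> mpolys ?n" using I.a_subset by simp
    show "0 \<in> genideal ?R (S k)" using I.zero_closed by simp
    show "p - q \<in> genideal ?R (S k)" if "p \<in> genideal ?R (S k)" "q \<in> genideal ?R (S k)"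
      using I.a_closed[OF that(1) I.a_inv_closed[OF that(2)]] I.a_subset that
      by (simp add: a_inv_mpoly_ring subset_iff)
    show "q * p \<in> genideal ?R (S k)" if "p \<in> genideal ?R (S k)" "q \<in> mpolys ?n"
      using I.I_l_closed[OF that(1)] that by simp
    have "S k \<subseteq> genideal ?R (S (Suc k))"
      using R.genideal_self[OF S[of "Suc k"]] by (auto simp: S_def lessThan_Suc)
    then show "genideal ?R (S k) \<subseteq> genideal ?R (S (Suc k))"
      by (rule R.genideal_minimal[OF I])
  qed
  then obtain k where k: "genideal ?R (S (Suc k)) = genideal ?R (S k)" ..
  have "q \<in> ideal_radical ?R (genideal ?R (S k))" if q: "q \<in> set ((comp_all G ^^ Suc k) ps)" for q
  proof -
    have "q \<in> S (Suc k)" unfolding S_def using q by blast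
    then have "q \<in> genideal ?R (S k)" using R.genideal_self[OF S[of "Suc k"]] k by blast
    moreover have "q \<in> mpolys ?n" using \<open>q \<in> S (Suc k)\<close> S by auto
    ultimately show ?thesis
      by (auto simp: ideal_radical_def mpoly_ring_pow intro!: exI[of _ 1])
  qed
  moreover have "(\<Union>qs\<in>set (map (\<lambda>l. (comp_all G ^^ l) ps) [0..<Suc k]). set qs) = S k"
    by (simp only: S_def set_map image_image atLeast_upt lessThan_atLeast0)
  ultimately have "\<not> is_test G ((is_step G ^^ k) (is_init ps G))"
    unfolding is_state_eq is_test_def by (simp only: prod.case subset_iff) blast
  then show ?thesis ..
qed

text \<open>Since the final test counts as an iteration, \<open>InvariantSet_iterations\<close>
  agrees with the number of collected sequences. With one polynomial per sequence it becomes the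
  number of rows of the computed matrix.\<close>

lemma InvariantSet_eq:
  assumes "set ps \<subseteq> mpolys (length G)" "set G \<subseteq> mpolys (length G)"
  shows "InvariantSet ps G = Some (map (\<lambda>l. (comp_all G ^^ l) ps) [0..<InvariantSet_iterations ps G])"
  using InvariantSet_terminates[OF assms]
  by (simp add: InvariantSet_def while_option_def is_state_eq InvariantSet_iterations_def del: upt_Suc)

lemma meval_comp_all:
  assumes "comm_ring_hom \<phi>"
  shows "map (meval \<phi> v) (comp_all G qs) = map (meval \<phi> (\<lambda>i. meval \<phi> v (G ! i))) qs"
  by (simp add: comp_all_def mcomp_def meval_comp[OF assms])

text \<open>
  The zero set of the computed polynomials is mapped into itself by \<open>G\<close>: the last of the
  successors vanishes on it by the radical membership test.
\<close>
lemma InvariantSet_complete: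
  fixes v :: "nat \<Rightarrow> complex"
  assumes "set ps \<subseteq> mpolys (length G)" "set G \<subseteq> mpolys (length G)"
    and "\<And>l q. l < InvariantSet_iterations ps G \<Longrightarrow> q \<in> set ((comp_all G ^^ l) ps) \<Longrightarrow> meval of_rat v q = 0"
    and "q \<in> set ((comp_all G ^^ l) ps)"
  shows "meval of_rat v q = 0"
proof -
  define K where "K = (LEAST k. \<not> is_test G ((is_step G ^^ k) (is_init ps G)))"
  have N: "InvariantSet_iterations ps G = Suc K" by (simp add: InvariantSet_iterations_def K_def)
  have K: "\<not> is_test G ((is_step G ^^ K) (is_init ps G))"
    unfolding K_def by (rule LeastI_ex) (rule InvariantSet_terminates[OF assms(1,2)])
  define Z where "Z = {v :: nat \<Rightarrow> complex. \<forall>l<Suc K. \<forall>q\<in>set ((comp_all G ^^ l) ps). meval of_rat v q = 0}"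
  let ?G = "\<lambda>v i. meval of_rat v (G ! i) :: complex"
  have succ: "meval of_rat v q = 0" if "v \<in> Z" "q \<in> set ((comp_all G ^^ Suc K) ps)" for v q
  proof (rule radical_vanishes[OF of_rat_comm_ring_hom])
    let ?S = "\<Union>qs\<in>set (map (\<lambda>l. (comp_all G ^^ l) ps) [0..<Suc K]). set qs"
    show "?S \<subseteq> mpolys (length G)" using comp_all_mpolys[OF assms(1,2)] by auto
    show "q \<in> ideal_radical (mpoly_ring (length G)) (genideal (mpoly_ring (length G)) ?S)"
      using K that(2) unfolding is_state_eq is_test_def by (simp only: prod.case) blast
    show "meval of_rat v s = 0" if "s \<in> ?S" for s
    proof -
      from that obtain l where "l < Suc K" "s \<in> set ((comp_all G ^^ l) ps)"
        by (auto simp del: upt_Suc)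
      with \<open>v \<in> Z\<close> show ?thesis unfolding Z_def by blast
    qed
  qed
  \<comment> \<open>Iterate \<open>l\<close> at the image point is iterate \<open>Suc l\<close> at
    \<open>v\<close>. So stability of \<open>Z\<close> amounts to raising the index by one, which
    leaves the collected range only for \<open>l = K\<close>.\<close>
  have shift: "(\<forall>q\<in>set ((comp_all G ^^ l) ps). meval of_rat (?G v) q = 0) \<longleftrightarrow>
      (\<forall>q\<in>set ((comp_all G ^^ Suc l) ps). meval of_rat v q = 0)" for v l
    using arg_cong[OF meval_comp_all[OF of_rat_comm_ring_hom, of v G "(comp_all G ^^ l) ps"], of "\<lambda>xs. \<forall>x\<in>set xs. x = 0"]
    by simp
  have stable: "?G v \<in> Z" if "v \<in> Z" for v
  proof -
    have "\<forall>q\<in>set ((comp_all G ^^ l) ps). meval of_rat (?G v) q = 0" if "l < Suc K" for l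
      unfolding shift
    proof (cases "l = K")
      case False
      with that have "Suc l < Suc K" by simp
      with \<open>v \<in> Z\<close> show "\<forall>q\<in>set ((comp_all G ^^ Suc l) ps). meval of_rat v q = 0"
        unfolding Z_def by blast
    qed (use succ[OF \<open>v \<in> Z\<close>] in blast)
    then show ?thesis by (simp add: Z_def)
  qed
  have "\<forall>q\<in>set ((comp_all G ^^ l) ps). meval of_rat v q = 0" if "v \<in> Z" for v
    using that
  proof (induction l arbitrary: v)
    case 0
    then show ?case by (auto simp: Z_def dest: spec[of _ 0])
  next
    case (Suc l)
    from Suc.IH[OF stable[OF Suc.prems]] show ?case by (simp only: shift)
  qed
  moreover have "v \<in> Z" using assms(3) by (auto simp: Z_def N simp del: funpow.simps)
  ultimately show ?thesis using assms(4) by blast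
qed


section \<open>ComputeMatrix\<close>

lemma mcomp_comm_ring_hom: "comm_ring_hom (\<lambda>p. mcomp p G)"
  unfolding mcomp_def by (rule Const_hom.comm_ring_hom_meval)

lemma mcomp_append: "p \<in> mpolys (length F) \<Longrightarrow> mcomp p (F @ G) = mcomp p F"
  unfolding mcomp_def by (rule meval_cong) (auto simp: nth_append)

lemma mcomp_Var: "mcomp (Var i) G = G ! i"
  by (simp add: mcomp_def Const_hom.meval_Var)

text \<open>The product of h(F^j) over j < l, where h is the product of the guards. The new factor
  stands in front and the old product is composed with F, because this is the effect of substituting
  z h for z.\<close>

fun guard_prod :: "rat mpoly list \<Rightarrow> rat mpoly list \<Rightarrow> nat \<Rightarrow> rat mpoly" where
  "guard_prod hs F 0 = 1"
| "guard_prod hs F (Suc l) = prod_list hs * mcomp (guard_prod hs F l) F"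

definition comp_iter :: "rat mpoly list \<Rightarrow> nat \<Rightarrow> rat mpoly \<Rightarrow> rat mpoly" where
  "comp_iter F l = (\<lambda>p. mcomp p F) ^^ l"

lemma guard_prod_mpolys:
  assumes "set hs \<subseteq> mpolys (length F)" "set F \<subseteq> mpolys (length F)"
  shows "guard_prod hs F l \<in> mpolys (length F)"
  by (induction l) (use assms in \<open>auto intro!: mpolys_mult mpolys_prod_list mpolys_mcomp\<close>)

lemma comp_iter_mpolys:
  assumes "p \<in> mpolys (length F)" "set F \<subseteq> mpolys (length F)"
  shows "comp_iter F l p \<in> mpolys (length F)"
  by (induction l) (use assms in \<open>auto simp: comp_iter_def intro!: mpolys_mcomp\<close>)

definition cm_poly :: "rat mpoly list \<Rightarrow> rat mpoly list \<Rightarrow> rat mpoly list \<Rightarrow> nat \<Rightarrow> rat mpoly" where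
  "cm_poly gs hs F l = Var (length F + length gs) *
     (guard_prod hs F l * (\<Sum>j<length gs. Var (length F + j) * comp_iter F l (gs ! j)))"

text \<open>Substitution acts factor by factor: it fixes each u_j, multiplies z by h, and agrees
  with composition by F on polynomials in x. So z remains a linear factor of every iterate, and
  setting it to 1 removes just this factor.\<close>

lemma cm_iterate:
  assumes "set gs \<subseteq> mpolys (length F)" "set hs \<subseteq> mpolys (length F)" "set F \<subseteq> mpolys (length F)"
  shows "(comp_all (cm_map gs hs F) ^^ l) (cm_input gs F) = [cm_poly gs hs F l]"
proof (induction l)
  case 0
  then show ?case by (simp add: cm_input_def cm_poly_def comp_iter_def Let_def)
next
  case (Suc l)
  let ?n = "length F" and ?m = "length gs"
  let ?G = "cm_map gs hs F"
  interpret mc: comm_ring_hom "\<lambda>p. mcomp p ?G" by (rule mcomp_comm_ring_hom)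
  have F: "mcomp p ?G = mcomp p F" if "p \<in> mpolys ?n" for p
    using that by (simp add: cm_map_def Let_def mcomp_append)
  have u: "mcomp (Var (?n + j)) ?G = Var (?n + j)" if "j < ?m" for j
    using that by (simp add: mcomp_Var cm_map_def Let_def nth_append)
  have z: "mcomp (Var (?n + ?m)) ?G = Var (?n + ?m) * prod_list hs"
    by (simp add: mcomp_Var cm_map_def Let_def nth_append)
  have gm: "gs ! j \<in> mpolys ?n" if "j < ?m" for j
    using nth_mem[OF that] assms(1) by blast
  have g: "mcomp (comp_iter F l (gs ! j)) ?G = comp_iter F (Suc l) (gs ! j)" if "j < ?m" for j
    using F[OF comp_iter_mpolys[OF gm[OF that] assms(3)], of l]
    by (simp add: comp_iter_def)
  have "mcomp (cm_poly gs hs F l) ?G = cm_poly gs hs F (Suc l)"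
    by (simp add: cm_poly_def mc.hom_mult mc.hom_sum u z g F guard_prod_mpolys assms mult.assoc)
  with Suc show ?case by (simp add: comp_all_def)
qed

lemma cm_map_mpolys:
  assumes "set hs \<subseteq> mpolys (length F)" "set F \<subseteq> mpolys (length F)"
  shows "set (cm_map gs hs F) \<subseteq> mpolys (length (cm_map gs hs F))"
proof -
  have "mpolys (length F) \<subseteq> (mpolys (Suc (length F + length gs)) :: rat mpoly set)" by (rule mpolys_mono) simp
  with assms show ?thesis by (auto simp: cm_map_def Let_def intro!: mpolys_mult mpolys_prod_list)
qed

lemma cm_input_mpolys:
  assumes "set gs \<subseteq> mpolys (length F)"
  shows "set (cm_input gs F) \<subseteq> mpolys (length (cm_map gs hs F))"
proof -
  have "mpolys (length F) \<subseteq> (mpolys (Suc (length F + length gs)) :: rat mpoly set)" by (rule mpolys_mono) simp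
  with assms have "gs ! j \<in> mpolys (Suc (length F + length gs))" if "j < length gs" for j
    using nth_mem[OF that] by blast
  then show ?thesis
    by (auto simp: cm_input_def cm_map_def Let_def intro!: mpolys_mult mpolys_sum)
qed

lemma comm_ring_hom_set_z: "comm_ring_hom (set_z_to_1 iz)"
  unfolding set_z_to_1_def by (rule Const_hom.comm_ring_hom_meval)

lemma meval_Const_fixed:
  assumes "p \<in> mpolys n" "\<And>i. i < n \<Longrightarrow> g i = Var i"
  shows "meval Const g p = (p :: 'a::comm_ring_1 mpoly)"
  using meval_cong[OF assms, where \<phi> = Const] by (simp add: meval_Const_Var)

lemma set_z_cm_poly:
  assumes "set gs \<subseteq> mpolys (length F)" "set hs \<subseteq> mpolys (length F)" "set F \<subseteq> mpolys (length F)"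
  shows "set_z_to_1 (length F + length gs) (cm_poly gs hs F l) =
     guard_prod hs F l * (\<Sum>j<length gs. Var (length F + j) * comp_iter F l (gs ! j))"
proof -
  let ?s = "set_z_to_1 (length F + length gs)"
  interpret s: comm_ring_hom ?s by (rule comm_ring_hom_set_z)
  have v: "?s (Var i) = (if i = length F + length gs then 1 else Var i)" for i
    by (simp add: set_z_to_1_def Const_hom.meval_Var)
  have f: "?s p = p" if "p \<in> mpolys (length F)" for p
    unfolding set_z_to_1_def by (rule meval_Const_fixed[OF that]) auto
  have "?s (comp_iter F l (gs ! j)) = comp_iter F l (gs ! j)" if "j < length gs" for j
    by (rule f, rule comp_iter_mpolys) (use that assms in auto)
  then show ?thesis
    by (simp add: cm_poly_def s.hom_mult s.hom_sum v f guard_prod_mpolys assms)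
qed

text \<open>Setting u_k to 1 and the other u_j to 0 isolates the k-th coefficient, since the
  coefficients involve only x. This is the uniqueness behind the definite description in
  \<open>ComputeMatrix\<close>.\<close>

lemma u_coeffs_unique:
  fixes c d :: "nat \<Rightarrow> 'a::comm_ring_1 mpoly"
  assumes "\<And>j. j < m \<Longrightarrow> c j \<in> mpolys n" "\<And>j. j < m \<Longrightarrow> d j \<in> mpolys n"
    and "(\<Sum>j<m. c j * Var (n + j)) = (\<Sum>j<m. d j * Var (n + j))"
    and "k < m"
  shows "c k = d k"
proof -
  define s :: "'a mpoly \<Rightarrow> 'a mpoly" where
    "s = meval Const (\<lambda>i. if i < n then Var i else if i = n + k then 1 else 0)"
  interpret s: comm_ring_hom s unfolding s_def by (rule Const_hom.comm_ring_hom_meval)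
  have f: "s p = p" if "p \<in> mpolys n" for p
    unfolding s_def by (rule meval_Const_fixed[OF that]) auto
  have v: "s (Var (n + j)) = (if j = k then 1 else 0)" for j
    by (simp add: s_def Const_hom.meval_Var)
  have "s (\<Sum>j<m. e j * Var (n + j)) = e k" if "\<And>j. j < m \<Longrightarrow> e j \<in> mpolys n" for e
    using that \<open>k < m\<close> by (simp add: s.hom_sum s.hom_mult v f sum.delta if_distrib cong: if_cong)
  from this[of c, OF assms(1)] this[of d, OF assms(2)] assms(3) show ?thesis by simp
qed

definition cm_matrix :: "rat mpoly list \<Rightarrow> rat mpoly list \<Rightarrow> rat mpoly list \<Rightarrow> nat \<Rightarrow> rat mpoly mat" where
  "cm_matrix gs hs F N = mat N (length gs) (\<lambda>(l, j). guard_prod hs F l * comp_iter F l (gs ! j))"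

lemma ComputeMatrix_eq:
  assumes "set gs \<subseteq> mpolys (length F)" "set hs \<subseteq> mpolys (length F)" "set F \<subseteq> mpolys (length F)"
  shows "ComputeMatrix gs hs F =
    Some (cm_matrix gs hs F (InvariantSet_iterations (cm_input gs F) (cm_map gs hs F)))"
proof -
  let ?n = "length F" and ?m = "length gs"
  define N where "N = InvariantSet_iterations (cm_input gs F) (cm_map gs hs F)"
  define u where "u = vec ?m (\<lambda>j. Var (?n + j) :: rat mpoly)"
  define P where "P l = guard_prod hs F l * (\<Sum>j<?m. Var (?n + j) * comp_iter F l (gs ! j))" for l
  define Ps where "Ps = map P [0..<N]"
  have S: "InvariantSet (cm_input gs F) (cm_map gs hs F) = Some (map (\<lambda>l. [cm_poly gs hs F l]) [0..<N])"
    by (simp add: InvariantSet_eq cm_input_mpolys cm_map_mpolys assms cm_iterate N_def)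
  have "map (set_z_to_1 (?n + ?m)) (concat (map (\<lambda>l. [cm_poly gs hs F l]) [0..<N])) = Ps"
    unfolding Ps_def P_def concat_map_singleton by (simp add: set_z_cm_poly assms)
  moreover have "(THE A. A \<in> carrier_mat (length Ps) ?m \<and> elements_mat A \<subseteq> mpolys ?n \<and>
      vec_of_list Ps = A *\<^sub>v u) = cm_matrix gs hs F N"
  proof (rule the_equality)
    have "guard_prod hs F l * comp_iter F l (gs ! j) \<in> mpolys ?n" if "j < ?m" for l j
      by (intro mpolys_mult guard_prod_mpolys comp_iter_mpolys) (use that assms in auto)
    then have "elements_mat (cm_matrix gs hs F N) \<subseteq> mpolys ?n"
      by (auto simp: elements_mat_def cm_matrix_def)
    moreover have "vec_of_list Ps = cm_matrix gs hs F N *\<^sub>v u"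
      by (rule eq_vecI)
        (auto simp: Ps_def P_def cm_matrix_def u_def scalar_prod_def sum_distrib_left vec_of_list_index
          lessThan_atLeast0 mult_ac intro!: sum.cong)
    ultimately show "cm_matrix gs hs F N \<in> carrier_mat (length Ps) ?m \<and> elements_mat (cm_matrix gs hs F N) \<subseteq> mpolys ?n \<and>
      vec_of_list Ps = cm_matrix gs hs F N *\<^sub>v u"
      by (simp add: Ps_def cm_matrix_def)
  next
    fix A assume "A \<in> carrier_mat (length Ps) ?m \<and> elements_mat A \<subseteq> mpolys ?n \<and> vec_of_list Ps = A *\<^sub>v u"
    then have A: "A \<in> carrier_mat N ?m" "elements_mat A \<subseteq> mpolys ?n" "vec_of_list Ps = A *\<^sub>v u"
      by (auto simp: Ps_def)
    show "A = cm_matrix gs hs F N"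
    proof (rule eq_matI)
      fix l k assume "l < dim_row (cm_matrix gs hs F N)" "k < dim_col (cm_matrix gs hs F N)"
      then have lk: "l < N" "k < ?m" by (auto simp: cm_matrix_def)
      have "A $$ (l, k) = guard_prod hs F l * comp_iter F l (gs ! k)"
      proof (rule u_coeffs_unique)
        show "A $$ (l, j) \<in> mpolys ?n" if "j < ?m" for j
          using elements_matI[OF A(1) lk(1) that refl] A(2) by blast
        show "guard_prod hs F l * comp_iter F l (gs ! j) \<in> mpolys ?n" if "j < ?m" for j
          by (intro mpolys_mult guard_prod_mpolys comp_iter_mpolys) (use that assms in auto)
        have "vec_of_list Ps $ l = (A *\<^sub>v u) $ l" using A(3) by simp
        then show "(\<Sum>j<?m. A $$ (l, j) * Var (?n + j)) =
            (\<Sum>j<?m. guard_prod hs F l * comp_iter F l (gs ! j) * Var (?n + j))"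
          using lk(1) A(1)
          by (simp add: Ps_def P_def vec_of_list_index u_def scalar_prod_def sum_distrib_left lessThan_atLeast0 mult_ac)
      qed (rule lk)
      with lk show "A $$ (l, k) = cm_matrix gs hs F N $$ (l, k)" by (simp add: cm_matrix_def)
    qed (use A in \<open>auto simp: cm_matrix_def\<close>)
  qed
  ultimately show ?thesis
    by (simp only: ComputeMatrix_def Let_def S N_def [symmetric] u_def [symmetric] option.map)
qed

section \<open>Evaluation of the matrix along an orbit\<close>

lemma qeval_comm_ring_hom: "comm_ring_hom (qeval a)"
  unfolding qeval_def by (rule comm_ring_hom.comm_ring_hom_meval[OF of_rat_comm_ring_hom])

lemma ceval_comm_ring_hom: "comm_ring_hom (ceval a)"
  unfolding ceval_def by (rule comm_ring_hom.comm_ring_hom_meval[OF id_comm_ring_hom])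

interpretation qeval: comm_ring_hom "qeval a" for a by (rule qeval_comm_ring_hom)
interpretation ceval: comm_ring_hom "ceval a" for a by (rule ceval_comm_ring_hom)

lemma qeval_mcomp:
  assumes "p \<in> mpolys (length F)"
  shows "qeval a (mcomp p F) = qeval (apply_map F a) p"
  unfolding qeval_def mcomp_def meval_comp[OF of_rat_comm_ring_hom]
  by (rule meval_cong[OF assms]) (simp add: apply_map_def qeval_def)

lemma lookup_map_zero: "\<phi> 0 = 0 \<Longrightarrow> Poly_Mapping.lookup (Poly_Mapping.map \<phi> p) k = \<phi> (Poly_Mapping.lookup p k)"
  by (simp add: Poly_Mapping.map.rep_eq when_def)

lemma ceval_complexify: "ceval a (complexify p) = qeval a p"
proof -
  have "Poly_Mapping.keys (complexify p) \<subseteq> Poly_Mapping.keys p"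
    by (auto simp: in_keys_iff complexify_def lookup_map_zero)
  then have "ceval a (complexify p) = (\<Sum>k\<in>Poly_Mapping.keys p. Poly_Mapping.lookup (complexify p) k * monom_eval (\<lambda>i. a $ i) k)"
    unfolding ceval_def by (subst meval_superset[of _ "Poly_Mapping.keys p"]) auto
  also have "\<dots> = qeval a p"
    unfolding qeval_def by (subst meval_superset[of _ "Poly_Mapping.keys p"])
      (auto simp: complexify_def lookup_map_zero)
  finally show ?thesis .
qed

lemma qeval_comp_iter:
  assumes "p \<in> mpolys (length F)" "set F \<subseteq> mpolys (length F)"
  shows "qeval a (comp_iter F l p) = qeval ((apply_map F ^^ l) a) p"
proof (induction l arbitrary: a)
  case 0
  then show ?case by (simp add: comp_iter_def)
next
  case (Suc l)
  have "qeval a (comp_iter F (Suc l) p) = qeval (apply_map F a) (comp_iter F l p)"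
    using qeval_mcomp[OF comp_iter_mpolys[OF assms]] by (simp add: comp_iter_def)
  then show ?case by (simp add: Suc funpow_swap1)
qed

lemma qeval_prod_list: "qeval a (prod_list hs) = 0 \<longleftrightarrow> (\<exists>h\<in>set hs. qeval a h = 0)"
  by (induction hs) (auto simp: qeval.hom_mult)

text \<open>A product in a field is nonzero iff all factors are, so the guard product records
  whether the l-th iterate is reached. If it is not, row l evaluates to zero and imposes nothing,
  just as the implication in \<open>poly_invariant\<close> becomes vacuous.\<close>

lemma qeval_guard_prod:
  assumes "set hs \<subseteq> mpolys (length F)" "set F \<subseteq> mpolys (length F)"
  shows "qeval a (guard_prod hs F l) \<noteq> 0 \<longleftrightarrow> (\<forall>j<l. \<forall>h\<in>set hs. qeval ((apply_map F ^^ j) a) h \<noteq> 0)"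
proof (induction l arbitrary: a)
  case (Suc l)
  have "qeval a (guard_prod hs F (Suc l)) \<noteq> 0 \<longleftrightarrow>
      (\<forall>h\<in>set hs. qeval a h \<noteq> 0) \<and> (\<forall>j<l. \<forall>h\<in>set hs. qeval ((apply_map F ^^ Suc j) a) h \<noteq> 0)"
    using Suc[of "apply_map F a"]
    by (simp add: qeval.hom_mult qeval_prod_list qeval_mcomp guard_prod_mpolys[OF assms] funpow_swap1)
  then show ?case by (simp only: All_less_Suc2) simp
qed simp

definition lin_comb :: "rat mpoly list \<Rightarrow> (nat \<Rightarrow> complex) \<Rightarrow> complex mpoly" where
  "lin_comb gs b = (\<Sum>j<length gs. mpoly_scale (b j) (complexify (gs ! j)))"

lemma ceval_lin_comb: "ceval a (lin_comb gs b) = (\<Sum>j<length gs. b j * qeval a (gs ! j))"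
proof -
  have "ceval a (Const c) = c" for c
    unfolding ceval_def by (rule comm_ring_hom.meval_Const[OF id_comm_ring_hom])
  then show ?thesis
    by (simp add: lin_comb_def ceval.hom_sum mpoly_scale_def ceval.hom_mult ceval_complexify)
qed

lemma invariant_iff_kernel:
  assumes "set gs \<subseteq> mpolys (length F)" "set hs \<subseteq> mpolys (length F)" "set F \<subseteq> mpolys (length F)"
    and N: "N = InvariantSet_iterations (cm_input gs F) (cm_map gs hs F)"
  shows "poly_invariant a hs F (lin_comb gs b) \<longleftrightarrow>
    (\<forall>l<N. (\<Sum>j<length gs. qeval a (cm_matrix gs hs F N $$ (l, j)) * b j) = 0)"
proof -
  let ?n = "length F" and ?m = "length gs"
  \<comment> \<open>The point (a, b, 1) of the extended space: \<open>a\<close> for x, the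
    coefficients \<open>b\<close> for u, and 1 for z, as no guard has been met at the start.\<close>
  define v where "v i = (if i < ?n then a $ i else if i < ?n + ?m then b (i - ?n) else 1)" for i
  define row where "row l = (\<Sum>j<?m. qeval a (guard_prod hs F l * comp_iter F l (gs ! j)) * b j)" for l
  interpret ev: comm_ring_hom "meval (of_rat :: rat \<Rightarrow> complex) v" by (rule comm_ring_hom.comm_ring_hom_meval[OF of_rat_comm_ring_hom])
  have e: "meval of_rat v p = qeval a p" if "p \<in> mpolys ?n" for p
    unfolding qeval_def by (rule meval_cong[OF that]) (simp add: v_def)
  have "meval of_rat v (comp_iter F l (gs ! j)) = qeval a (comp_iter F l (gs ! j))" if "j < ?m" for l j
    by (rule e, rule comp_iter_mpolys) (use that assms in auto)
  then have row: "meval of_rat v (cm_poly gs hs F l) = row l" for l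
    by (simp add: cm_poly_def row_def ev.hom_mult ev.hom_sum comm_ring_hom.meval_Var[OF of_rat_comm_ring_hom] v_def e guard_prod_mpolys
        assms qeval.hom_mult sum_distrib_left mult_ac)
  have "row l = qeval a (guard_prod hs F l) * ceval ((apply_map F ^^ l) a) (lin_comb gs b)" for l
  proof -
    have "qeval a (comp_iter F l (gs ! j)) = qeval ((apply_map F ^^ l) a) (gs ! j)" if "j < ?m" for j
      by (rule qeval_comp_iter) (use that assms in auto)
    then show ?thesis
      by (simp add: row_def ceval_lin_comb qeval.hom_mult sum_distrib_left mult_ac)
  qed
  then have "poly_invariant a hs F (lin_comb gs b) \<longleftrightarrow> (\<forall>l. row l = 0)"
    unfolding poly_invariant_def qeval_guard_prod[OF assms(2,3), symmetric] by auto
  also have "\<dots> \<longleftrightarrow> (\<forall>l<N. row l = 0)"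
  proof
    assume *: "\<forall>l<N. row l = 0"
    show "\<forall>l. row l = 0"
    proof
      fix l
      have "meval of_rat v (cm_poly gs hs F l) = 0"
        by (rule InvariantSet_complete[of "cm_input gs F" "cm_map gs hs F" v _ l])
          (use * in \<open>auto simp: cm_input_mpolys cm_map_mpolys assms cm_iterate row simp flip: N\<close>)
      then show "row l = 0" by (simp add: row)
    qed
  qed simp
  finally show ?thesis by (simp add: row_def cm_matrix_def)
qed


section \<open>Kernels of matrices with vanishing minors\<close>

lemma in_index_sets: "I \<in> set (index_sets r t) \<longleftrightarrow> I \<subseteq> {..<r} \<and> card I = t"
  by (auto simp: index_sets_def subseqs_powset lessThan_atLeast0)

lemma det_submatrix_in_minors:
  "I \<in> set (index_sets (dim_row A) k) \<Longrightarrow> J \<in> set (index_sets (dim_col A) k) \<Longrightarrow>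
    det (submatrix A I J) \<in> set (minors k A)"
  by (simp add: minors_def) blast

lemma length_index_sets: "length (index_sets r t) = r choose t"
proof -
  have "distinct (index_sets r t)" unfolding index_sets_def by (intro distinct_filter distinct_set_subseqs) simp
  then have "length (index_sets r t) = card (set (index_sets r t))" by (simp add: distinct_card)
  also have "set (index_sets r t) = {I. I \<subseteq> {..<r} \<and> card I = t}" by (auto simp: in_index_sets)
  finally show ?thesis by (simp add: n_subsets)
qed

lemma bij_betw_pick:
  assumes "finite S"
  shows "bij_betw (pick S) {..<card S} S"
proof -
  have inj: "inj_on (pick S) {..<card S}"
    by (rule linorder_inj_onI') (use pick_mono_le in fastforce)
  moreover have "pick S ` {..<card S} \<subseteq> S" using pick_in_set_le by auto
  ultimately show ?thesis
    unfolding bij_betw_def using card_subset_eq[OF assms] by (simp add: card_image)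
qed

lemma Int_lessThan: "I \<subseteq> {..<r} \<Longrightarrow> {i. i < r \<and> i \<in> I} = I"
  by auto

lemma submatrix_eq_mat:
  assumes "I \<subseteq> {..<dim_row A}" "J \<subseteq> {..<dim_col A}"
  shows "submatrix A I J = mat (card I) (card J) (\<lambda>(p, q). A $$ (pick I p, pick J q))"
  using assms by (simp add: submatrix_def Int_lessThan)

text \<open>\<open>submatrix\<close> lists its rows in increasing order, whereas a bordered matrix
  puts the extra row last. Two enumerations of the same set differ by a permutation, which costs the
  determinant only a sign.\<close>

lemma enumeration_eq_permuted_pick:
  assumes "finite R" "inj_on f {..<k}" "f ` {..<k} = R"
  obtains \<pi> where "\<pi> permutes {0..<k}" "\<And>p. p < k \<Longrightarrow> f p = pick R (\<pi> p)"
proof -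
  have k: "card R = k" using card_image[OF assms(2)] assms(3) by simp
  have b: "bij_betw (pick R) {..<k} R" using bij_betw_pick[OF assms(1)] k by simp
  have f: "bij_betw f {..<k} R" using assms by (auto simp: bij_betw_def)
  define \<pi> where "\<pi> p = (if p < k then inv_into {..<k} (pick R) (f p) else p)" for p
  have "bij_betw (inv_into {..<k} (pick R) \<circ> f) {..<k} {..<k}"
    using f bij_betw_inv_into[OF b] by (rule bij_betw_trans)
  then have "bij_betw \<pi> {..<k} {..<k}"
    by (rule bij_betw_cong[THEN iffD1, rotated]) (simp add: \<pi>_def)
  then have "\<pi> permutes {0..<k}"
    by (intro bij_imp_permutes) (auto simp: \<pi>_def lessThan_atLeast0)
  moreover have "f p = pick R (\<pi> p)" if "p < k" for p
  proof -
    have "f p \<in> R" using that assms(3) by auto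
    then show ?thesis using bij_betw_inv_into_right[OF b] that by (simp add: \<pi>_def)
  qed
  ultimately show ?thesis using that by blast
qed

lemma det_rows_reindex:
  assumes "finite R" "inj_on f {..<k}" "f ` {..<k} = R"
    and "det (mat k k (\<lambda>(p, q). h (pick R p) q)) = (0 :: 'a::comm_ring_1)"
  shows "det (mat k k (\<lambda>(p, q). h (f p) q)) = 0"
proof -
  obtain \<pi> where \<pi>: "\<pi> permutes {0..<k}" "\<And>p. p < k \<Longrightarrow> f p = pick R (\<pi> p)"
    using enumeration_eq_permuted_pick[OF assms(1-3)] by blast
  let ?B = "mat k k (\<lambda>(p, q). h (pick R p) q)"
  have "mat k k (\<lambda>(p, q). h (f p) q) = mat k k (\<lambda>(p, q). ?B $$ (\<pi> p, q))"
    using permutes_in_image[OF \<pi>(1)] by (intro eq_matI) (auto simp: \<pi>(2))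
  also have "det \<dots> = signof \<pi> * det ?B" by (rule det_permute_rows) (use \<pi> in auto)
  finally show ?thesis using assms(4) by simp
qed

text \<open>A repeated index produces two equal rows or columns, which is the case where a border
  row or column is itself a pivot. Otherwise the determinant is, up to sign, one of the listed
  minors; columns are reordered by transposing.\<close>

lemma det_reindex_zero:
  fixes A :: "'a::comm_ring_1 mat"
  assumes minors: "\<And>x. x \<in> set (minors k A) \<Longrightarrow> x = 0"
    and f: "\<And>p. p < k \<Longrightarrow> f p < dim_row A" and g: "\<And>q. q < k \<Longrightarrow> g q < dim_col A"
  shows "det (mat k k (\<lambda>(p, q). A $$ (f p, g q))) = 0"
proof -
  let ?B = "mat k k (\<lambda>(p, q). A $$ (f p, g q))"
  consider "\<not> inj_on f {..<k}" | "\<not> inj_on g {..<k}" | "inj_on f {..<k}" "inj_on g {..<k}" by blast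
  then show ?thesis
  proof cases
    case 1
    then obtain i j where ij: "i < k" "j < k" "i \<noteq> j" "f i = f j" by (auto simp: inj_on_def)
    show ?thesis
      by (rule det_identical_rows[of _ k i j]) (use ij in \<open>auto simp: vec_eq_iff\<close>)
  next
    case 2
    then obtain i j where ij: "i < k" "j < k" "i \<noteq> j" "g i = g j" by (auto simp: inj_on_def)
    show ?thesis
      by (rule det_identical_columns[of _ k i j]) (use ij in \<open>auto simp: vec_eq_iff\<close>)
  next
    case 3
    let ?R = "f ` {..<k}" and ?C = "g ` {..<k}"
    have RC: "?R \<subseteq> {..<dim_row A}" "?C \<subseteq> {..<dim_col A}" "card ?R = k" "card ?C = k"
      using f g 3 by (auto simp: card_image)
    then have "?R \<in> set (index_sets (dim_row A) k)" "?C \<in> set (index_sets (dim_col A) k)"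
      by (simp_all only: in_index_sets)
    then have "det (submatrix A ?R ?C) \<in> set (minors k A)"
      by (rule det_submatrix_in_minors)
    then have "det (submatrix A ?R ?C) = 0" by (rule minors)
    then have "det (mat k k (\<lambda>(p, q). A $$ (pick ?R p, pick ?C q))) = 0"
      using RC by (simp add: submatrix_eq_mat)
    then have 0: "det (mat k k (\<lambda>(p, q). A $$ (f p, pick ?C q))) = 0"
      by (rule det_rows_reindex[rotated 3]) (use 3 in auto)
    have "transpose_mat (mat k k (\<lambda>(p, q). A $$ (f p, pick ?C q))) = mat k k (\<lambda>(q, p). A $$ (f p, pick ?C q))"
      by (rule eq_matI) auto
    with 0 have "det (mat k k (\<lambda>(q, p). A $$ (f p, pick ?C q))) = 0"
      by (metis det_transpose mat_carrier)
    then have 0: "det (mat k k (\<lambda>(q, p). A $$ (f p, g q))) = 0"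
      by (rule det_rows_reindex[rotated 3]) (use 3 in auto)
    have "transpose_mat (mat k k (\<lambda>(p, q). A $$ (f p, g q))) = mat k k (\<lambda>(q, p). A $$ (f p, g q))"
      by (rule eq_matI) auto
    with 0 show ?thesis by (metis det_transpose mat_carrier)
  qed
qed

text \<open>
  Expanding the determinant of the submatrix bordered by row \<open>i\<close> and column \<open>j\<close> along its last
  column; the cofactors do not depend on \<open>j\<close>.
\<close>
lemma row_combination:
  fixes A :: "'a::comm_ring_1 mat"
  assumes "\<And>x. x \<in> set (minors (Suc t) A) \<Longrightarrow> x = 0"
    and I: "I \<subseteq> {..<dim_row A}" "card I = t" and J: "J \<subseteq> {..<dim_col A}" "card J = t"
    and i: "i < dim_row A"
  obtains y where "\<And>j. j < dim_col A \<Longrightarrow> det (submatrix A I J) * A $$ (i, j) = (\<Sum>p<t. y p * A $$ (pick I p, j))"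
proof -
  let ?f = "\<lambda>p. if p < t then pick I p else i" and ?g = "\<lambda>j q. if q < t then pick J q else j"
  define B where "B j = mat (Suc t) (Suc t) (\<lambda>(p, q). A $$ (?f p, ?g j q))" for j
  have B: "B j \<in> carrier_mat (Suc t) (Suc t)" for j by (simp add: B_def)
  have pI: "pick I p < dim_row A" if "p < t" for p using pick_in_set_le[of p I] that I by auto
  have pJ: "pick J p < dim_col A" if "p < t" for p using pick_in_set_le[of p J] that J by auto
  have del: "mat_delete (B j) p t = mat_delete (B 0) p t" if "p \<le> t" for p j
    by (rule eq_matI) (use that in \<open>auto simp: B_def mat_delete_def\<close>)
  have cof: "cofactor (B j) p t = cofactor (B 0) p t" if "p \<le> t" for p j
    by (simp add: cofactor_def del[OF that, of j])
  \<comment> \<open>Deleting the border leaves the pivot block, and the cofactor sign is positive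
    because the exponent \<open>t + t\<close> is even. Column 0 is only a reference value, deleted
    together with the border.\<close>
  have "mat_delete (B 0) t t = submatrix A I J"
    unfolding submatrix_eq_mat[OF I(1) J(1)] by (rule eq_matI) (auto simp: B_def mat_delete_def I J)
  then have last: "cofactor (B 0) t t = det (submatrix A I J)"
    by (simp add: cofactor_def flip: mult_2)
  show ?thesis
  proof (rule that)
    fix j assume j: "j < dim_col A"
    have "det (B j) = 0" unfolding B_def
      by (rule det_reindex_zero) (use assms(1) i j pI pJ in auto)
    also have "det (B j) = (\<Sum>p<Suc t. B j $$ (p, t) * cofactor (B j) p t)"
      by (rule laplace_expansion_column[OF B]) simp
    also have "\<dots> = (\<Sum>p<t. B j $$ (p, t) * cofactor (B 0) p t) + B j $$ (t, t) * cofactor (B 0) t t"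
      by (simp add: cof[of _ j])
    also have "\<dots> = (\<Sum>p<t. A $$ (pick I p, j) * cofactor (B 0) p t) + A $$ (i, j) * det (submatrix A I J)"
      unfolding last by (simp add: B_def)
    finally show "det (submatrix A I J) * A $$ (i, j) = (\<Sum>p<t. (- cofactor (B 0) p t) * A $$ (pick I p, j))"
      by (simp add: sum_negf mult.commute eq_neg_iff_add_eq_0 add.commute)
  qed
qed

lemma kernel_iff_pivot_rows:
  fixes A :: "'a::field mat"
  assumes "\<And>x. x \<in> set (minors (Suc t) A) \<Longrightarrow> x = 0"
    and I: "I \<subseteq> {..<dim_row A}" "card I = t" and J: "J \<subseteq> {..<dim_col A}" "card J = t"
    and d: "det (submatrix A I J) \<noteq> 0"
  shows "(\<forall>i<dim_row A. (\<Sum>j<dim_col A. A $$ (i, j) * b j) = 0) \<longleftrightarrow>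
    (\<forall>p<t. (\<Sum>j<dim_col A. A $$ (pick I p, j) * b j) = 0)" (is "?L \<longleftrightarrow> ?R")
proof
  assume ?L
  moreover have "pick I p < dim_row A" if "p < t" for p using pick_in_set_le[of p I] that I by auto
  ultimately show ?R by blast
next
  assume R: ?R
  show ?L
  proof (intro allI impI)
    fix i assume i: "i < dim_row A"
    obtain y where y: "\<And>j. j < dim_col A \<Longrightarrow> det (submatrix A I J) * A $$ (i, j) = (\<Sum>p<t. y p * A $$ (pick I p, j))"
      using row_combination[OF assms(1) I J i] by blast
    have "det (submatrix A I J) * (\<Sum>j<dim_col A. A $$ (i, j) * b j)
        = (\<Sum>j<dim_col A. (\<Sum>p<t. y p * A $$ (pick I p, j)) * b j)"
      by (simp add: sum_distrib_left mult.assoc [symmetric] y)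
    also have "\<dots> = (\<Sum>p<t. y p * (\<Sum>j<dim_col A. A $$ (pick I p, j) * b j))"
      by (simp add: sum_distrib_left sum_distrib_right mult.assoc) (rule sum.swap)
    also have "\<dots> = 0" using R by simp
    finally show "(\<Sum>j<dim_col A. A $$ (i, j) * b j) = 0" using d by simp
  qed
qed

section \<open>Cramer's rule and the parametrization of kernels\<close>

lemma smult_one_mult_vec: "x \<in> carrier_vec t \<Longrightarrow> (k \<cdot>\<^sub>m 1\<^sub>m t) *\<^sub>v x = k \<cdot>\<^sub>v (x :: 'a::comm_ring_1 vec)"
  by (rule eq_vecI) (auto simp: scalar_prod_def mult.assoc if_distrib[of "(*) _"] if_distrib[of "\<lambda>y. y * _"] sum.delta cong: if_cong)

text \<open>Cramer's rule with the determinant kept as a factor: multiply by the adjugate in one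
  direction and by M in the other, then cancel \<open>det M\<close>.\<close>

lemma adj_mat_solve:
  fixes M :: "'a::field mat"
  assumes M: "M \<in> carrier_mat t t" and d: "det M \<noteq> 0" and x: "x \<in> carrier_vec t" and w: "w \<in> carrier_vec t"
  shows "M *\<^sub>v x = w \<longleftrightarrow> det M \<cdot>\<^sub>v x = adj_mat M *\<^sub>v w"
proof
  note a = adj_mat[OF M]
  { assume "M *\<^sub>v x = w"
    then have "adj_mat M *\<^sub>v w = (adj_mat M * M) *\<^sub>v x"
      using assoc_mult_mat_vec[OF a(1) M x] by simp
    also have "\<dots> = det M \<cdot>\<^sub>v x" using x a(3) by (simp add: smult_one_mult_vec)
    finally show "det M \<cdot>\<^sub>v x = adj_mat M *\<^sub>v w" by simp }
  { assume *: "det M \<cdot>\<^sub>v x = adj_mat M *\<^sub>v w"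
    have "det M \<cdot>\<^sub>v (M *\<^sub>v x) = M *\<^sub>v (det M \<cdot>\<^sub>v x)"
      using mult_mat_vec[OF M x] by simp
    also have "\<dots> = (M * adj_mat M) *\<^sub>v w" unfolding * using assoc_mult_mat_vec[OF M a(1) w] by simp
    also have "\<dots> = det M \<cdot>\<^sub>v w" using w a(2) by (simp add: smult_one_mult_vec)
    finally have e: "det M \<cdot>\<^sub>v (M *\<^sub>v x) = det M \<cdot>\<^sub>v w" .
    have "(M *\<^sub>v x) $ p = w $ p" if "p < t" for p
      using arg_cong[OF e, of "\<lambda>v. v $ p"] M w that d by simp
    then show "M *\<^sub>v x = w" using M w by (intro eq_vecI) auto }
qed

lemma card_compl_lessThan: "J \<subseteq> {..<m} \<Longrightarrow> card {j. j < m \<and> j \<in> - J} = m - card J"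
proof -
  assume J: "J \<subseteq> {..<m}"
  have "{j. j < m \<and> j \<in> - J} = {..<m} - J" by auto
  then show ?thesis using J by (simp add: card_Diff_subset finite_subset)
qed

text \<open>The set \<open>- J\<close> is infinite, but the bound on l keeps \<open>pick\<close>
  within the first m columns, where it enumerates the free, that is nonpivot, columns.\<close>

lemma pick_compl:
  assumes "J \<subseteq> {..<m}" "l < m - card J"
  shows "pick (- J) l = pick ({..<m} - J) l"
proof -
  have "{j. j < m \<and> j \<in> - J} = {..<m} - J" by auto
  then show ?thesis using pick_reduce_set[of l m "- J"] assms card_compl_lessThan[OF assms(1)] by simp
qed

lemma bij_betw_pick_compl:
  assumes "J \<subseteq> {..<m}"
  shows "bij_betw (pick (- J)) {..<m - card J} ({..<m} - J)"
proof -
  have "card ({..<m} - J) = m - card J" using assms by (simp add: card_Diff_subset finite_subset)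
  then have "bij_betw (pick ({..<m} - J)) {..<m - card J} ({..<m} - J)"
    using bij_betw_pick[of "{..<m} - J"] by simp
  then show ?thesis
    by (rule bij_betw_cong[THEN iffD1, rotated]) (simp add: pick_compl[OF assms])
qed

lemma sum_pick_split:
  fixes f :: "nat \<Rightarrow> 'a::comm_monoid_add"
  assumes "J \<subseteq> {..<m}"
  shows "(\<Sum>j<m. f j) = (\<Sum>q<card J. f (pick J q)) + (\<Sum>l<m - card J. f (pick (- J) l))"
proof -
  have fin: "finite J" using assms finite_subset by auto
  have "(\<Sum>j<m. f j) = sum f J + sum f ({..<m} - J)"
    using sum.subset_diff[OF assms, of f] by (simp add: add.commute)
  then show ?thesis
    by (simp add: sum.reindex_bij_betw[OF bij_betw_pick[OF fin], symmetric]
        sum.reindex_bij_betw[OF bij_betw_pick_compl[OF assms], symmetric])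
qed

lemma pivot_cases:
  assumes "J \<subseteq> {..<m}" "j < m"
  obtains q where "q < card J" "j = pick J q" | l where "l < m - card J" "j = pick (- J) l"
proof (cases "j \<in> J")
  case True
  have "finite J" using assms finite_subset by auto
  from True bij_betw_imp_surj_on[OF bij_betw_pick[OF this]] that(1) show ?thesis by blast
next
  case False
  with assms(2) bij_betw_imp_surj_on[OF bij_betw_pick_compl[OF assms(1)]] that(2) show ?thesis by blast
qed

text \<open>
  By Cramer's rule the entries of the kernel matrix have the common denominator \<open>det M\<close>;
  these are the numerators.
\<close>
definition kernel_num :: "'a::comm_ring_1 mat \<Rightarrow> nat set \<Rightarrow> nat set \<Rightarrow> nat \<Rightarrow> nat \<Rightarrow> 'a" where
  "kernel_num A I J j l =
     (if j \<in> J then - (\<Sum>s<card I. adj_mat (submatrix A I J) $$ (card {k\<in>J. k < j}, s) * A $$ (pick I s, pick (- J) l))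
      else if j = pick (- J) l then det (submatrix A I J) else 0)"

text \<open>The cardinality in \<open>kernel_num\<close> is the position of j in the increasing list
  of J, so it inverts \<open>pick J\<close>. The pivot rows thus form the block -adj(M) M'.\<close>

lemma kernel_num_pivot:
  "q < card J \<Longrightarrow> kernel_num A I J (pick J q) l =
    - (\<Sum>s<card I. adj_mat (submatrix A I J) $$ (q, s) * A $$ (pick I s, pick (- J) l))"
  by (simp add: kernel_num_def pick_in_set_le card_pick_le)

text \<open>The free rows form \<open>det M\<close> times an identity block. This makes the
  parameters of a kernel vector unique, and later gives linear independence.\<close>

lemma kernel_num_nonpivot:
  assumes "J \<subseteq> {..<m}" "l < m - card J" "l' < m - card J"
  shows "kernel_num A I J (pick (- J) l') l = (if l' = l then det (submatrix A I J) else 0)"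
proof -
  note b = bij_betw_pick_compl[OF assms(1)]
  have "pick (- J) l' \<notin> J" using bij_betw_apply[OF b, of l'] assms by auto
  moreover have "pick (- J) l' = pick (- J) l \<longleftrightarrow> l' = l"
    using bij_betw_imp_inj_on[OF b] assms by (auto simp: inj_on_def)
  ultimately show ?thesis by (simp add: kernel_num_def)
qed

text \<open>The parameters are the free coordinates of b. Given these, the pivot rows are a square
  system for the remaining coordinates, solved by Cramer's rule; conversely the identity block
  forces any parameter vector to consist of the free coordinates of b.\<close>

lemma kernel_parametrization:
  fixes A :: "'a::field mat"
  assumes "\<And>x. x \<in> set (minors (Suc t) A) \<Longrightarrow> x = 0"
    and I: "I \<subseteq> {..<dim_row A}" "card I = t" and J: "J \<subseteq> {..<dim_col A}" "card J = t"
    and d: "det (submatrix A I J) \<noteq> 0"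
  defines "m \<equiv> dim_col A"
  shows "(\<forall>i<dim_row A. (\<Sum>j<m. A $$ (i, j) * b j) = 0) \<longleftrightarrow>
    (\<exists>c. \<forall>j<m. b j = (\<Sum>l<m - t. c l * (kernel_num A I J j l / det (submatrix A I J))))"
    (is "?L \<longleftrightarrow> ?R")
proof -
  define M where "M = submatrix A I J"
  have M: "M \<in> carrier_mat t t" unfolding M_def submatrix_eq_mat[OF I(1) J(1)] by (simp add: I J)
  note a = adj_mat[OF M]
  define c where "c l = b (pick (- J) l)" for l
  define x where "x = vec t (\<lambda>q. b (pick J q))"
  define w where "w = vec t (\<lambda>p. - (\<Sum>l<m - t. A $$ (pick I p, pick (- J) l) * c l))"
  have d': "det M \<noteq> 0" using d by (simp add: M_def)
  have unit: "(\<Sum>l'<m - t. e l' * (kernel_num A I J (pick (- J) l) l' / det M)) = e l" if "l < m - t" for e l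
  proof -
    have "(\<Sum>l'<m - t. e l' * (kernel_num A I J (pick (- J) l) l' / det M)) = (\<Sum>l'<m - t. if l = l' then e l' else 0)"
      using that d' J by (intro sum.cong) (auto simp: kernel_num_nonpivot[OF J(1)] M_def m_def)
    also have "\<dots> = e l" using that by simp
    finally show ?thesis .
  qed
  have "?L \<longleftrightarrow> (\<forall>p<t. (\<Sum>j<m. A $$ (pick I p, j) * b j) = 0)"
    unfolding m_def by (rule kernel_iff_pivot_rows[OF assms(1) I J d])
  also have "\<dots> \<longleftrightarrow> (\<forall>p<t. (M *\<^sub>v x) $ p = w $ p)"
    using M by (auto simp: sum_pick_split[OF J(1)[folded m_def]] J x_def w_def c_def scalar_prod_def
        submatrix_eq_mat[OF I(1) J(1)] M_def I atLeast0LessThan eq_neg_iff_add_eq_0)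
  also have "\<dots> \<longleftrightarrow> M *\<^sub>v x = w" using M by (auto simp: vec_eq_iff w_def)
  also have "\<dots> \<longleftrightarrow> det M \<cdot>\<^sub>v x = adj_mat M *\<^sub>v w"
    by (rule adj_mat_solve[OF M]) (use d in \<open>auto simp: M_def x_def w_def\<close>)
  also have "\<dots> \<longleftrightarrow> (\<forall>q<t. det M * b (pick J q) = (\<Sum>l<m - t. c l * kernel_num A I J (pick J q) l))"
  proof -
    have "(adj_mat M *\<^sub>v w) $ q = (\<Sum>l<m - t. c l * kernel_num A I J (pick J q) l)" if "q < t" for q
    proof -
      have "(adj_mat M *\<^sub>v w) $ q = (\<Sum>s<t. adj_mat M $$ (q, s) * - (\<Sum>l<m - t. A $$ (pick I s, pick (- J) l) * c l))"
        using that a(1) by (simp add: scalar_prod_def w_def atLeast0LessThan)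
      also have "\<dots> = (\<Sum>s<t. \<Sum>l<m - t. - (c l * (adj_mat M $$ (q, s) * A $$ (pick I s, pick (- J) l))))"
        by (simp add: sum_distrib_left sum_negf mult_ac)
      also have "\<dots> = (\<Sum>l<m - t. \<Sum>s<t. - (c l * (adj_mat M $$ (q, s) * A $$ (pick I s, pick (- J) l))))"
        by (rule sum.swap)
      also have "\<dots> = (\<Sum>l<m - t. c l * kernel_num A I J (pick J q) l)"
        using that by (simp add: kernel_num_pivot J I M_def sum_distrib_left sum_negf)
      finally show ?thesis .
    qed
    then show ?thesis using a(1) by (auto simp: vec_eq_iff x_def)
  qed
  also have "\<dots> \<longleftrightarrow> (\<forall>j<m. b j = (\<Sum>l<m - t. c l * (kernel_num A I J j l / det M)))" (is "?P \<longleftrightarrow> ?Q")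
  proof
    assume P: ?P
    show ?Q
    proof (intro allI impI)
      fix j assume "j < m"
      with J(1) consider q where "q < t" "j = pick J q" | l where "l < m - t" "j = pick (- J) l"
        unfolding m_def J(2) [symmetric] by (rule pivot_cases)
      then show "b j = (\<Sum>l<m - t. c l * (kernel_num A I J j l / det M))"
      proof cases
        case (1 q)
        then have "det M * b j = (\<Sum>l<m - t. c l * kernel_num A I J j l)" using P by simp
        then have "b j = (\<Sum>l<m - t. c l * kernel_num A I J j l) / det M" using d' by (simp add: field_simps)
        then show ?thesis by (simp add: sum_divide_distrib)
      next
        case (2 l)
        then show ?thesis by (simp only: unit) (simp add: c_def)
      qed
    qed
  next
    assume Q: ?Q
    show ?P
    proof (intro allI impI)
      fix q assume "q < t"
      then have "pick J q < m" using pick_in_set_le[of q J] J by (auto simp: m_def)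
      with Q have "b (pick J q) = (\<Sum>l<m - t. c l * (kernel_num A I J (pick J q) l / det M))" by blast
      then show "det M * b (pick J q) = (\<Sum>l<m - t. c l * kernel_num A I J (pick J q) l)"
        using d' by (simp add: sum_distrib_left)
    qed
  qed
  also have "\<dots> \<longleftrightarrow> ?R"
  proof
    assume ?R
    then obtain e where e: "\<And>j. j < m \<Longrightarrow> b j = (\<Sum>l<m - t. e l * (kernel_num A I J j l / det M))"
      unfolding M_def by blast
    have "c l = e l" if "l < m - t" for l
    proof -
      have "pick (- J) l < m"
        using bij_betw_apply[OF bij_betw_pick_compl[OF J(1)], of l] that J(2) by (simp add: m_def)
      from e[OF this] show ?thesis by (simp only: unit[OF that]) (simp add: c_def)
    qed
    with e show "\<forall>j<m. b j = (\<Sum>l<m - t. c l * (kernel_num A I J j l / det M))" by simp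
  qed (auto simp: M_def)
  finally show ?thesis .
qed


section \<open>The kernel matrix\<close>

lemma sorted_list_of_set_pick:
  assumes "finite S"
  shows "sorted_list_of_set S = map (pick S) [0..<card S]"
proof -
  have "sorted_wrt (<) (map (pick S) [0..<card S])"
    by (simp add: sorted_wrt_map sorted_wrt_iff_nth_less pick_mono_le)
  moreover have "set (map (pick S) [0..<card S]) = S"
    using bij_betw_imp_surj_on[OF bij_betw_pick[OF assms]] by (simp add: atLeast0LessThan)
  ultimately show ?thesis using assms
    by (metis sorted_list_of_set.idem_if_sorted_distinct strict_sorted_iff)
qed

section \<open>Passage to the fraction field\<close>

lemma to_frac_comm_ring_hom: "comm_ring_hom (to_frac :: 'a::idom \<Rightarrow> 'a fract)"
  by unfold_locales (simp_all add: to_frac_def Zero_fract_def One_fract_def)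

interpretation to_frac: comm_ring_hom "to_frac :: 'a::idom \<Rightarrow> 'a fract"
  by (rule to_frac_comm_ring_hom)

lemma to_frac_eq_0_iff [simp]: "to_frac x = 0 \<longleftrightarrow> x = 0"
  by (simp add: to_frac_def Zero_fract_def eq_fract)

lemma to_frac_divide: "y \<noteq> 0 \<Longrightarrow> to_frac x / to_frac y = Fraction_Field.Fract x y"
  by (simp add: to_frac_def)

context comm_ring_hom
begin

text \<open>Such transfers are used for two homomorphisms, \<open>to_frac\<close> and
  \<open>qeval a\<close>: minors and adjugates computed once over the polynomials yield both the
  symbolic kernel matrix and its value at a point.\<close>

lemma hom_submatrix: "submatrix (map_mat hom A) I J = map_mat hom (submatrix A I J)"
  by (rule eq_matI) (auto simp: submatrix_def pick_le)

lemma hom_cofactor: "A \<in> carrier_mat n n \<Longrightarrow> i < n \<Longrightarrow> j < n \<Longrightarrow> cofactor (map_mat hom A) i j = hom (cofactor A i j)"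
proof -
  assume "A \<in> carrier_mat n n" "i < n" "j < n"
  then have "mat_delete (map_mat hom A) i j = map_mat hom (mat_delete A i j)"
    by (intro eq_matI) (auto simp: mat_delete_def)
  then show ?thesis by (simp add: cofactor_def hom_mult hom_power hom_uminus)
qed

lemma hom_adj_mat: "A \<in> carrier_mat n n \<Longrightarrow> adj_mat (map_mat hom A) = map_mat hom (adj_mat A)"
  by (rule eq_matI) (auto simp: adj_mat_def hom_cofactor)

end

text \<open>\<open>mat_inverse\<close> runs Gauss-Jordan elimination, whose output has no visible
  formula. For a right inverse B, the product adj(M) M B is \<open>det M\<close> times B as well as
  adj(M), which fixes the entries of B.\<close>

lemma mat_inverse_eq_adj:
  fixes M :: "'a::field mat"
  assumes M: "M \<in> carrier_mat t t" and d: "det M \<noteq> 0"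
  shows "the (mat_inverse M) = mat t t (\<lambda>(i, j). adj_mat M $$ (i, j) / det M)"
proof -
  note a = adj_mat[OF M]
  obtain B where B: "mat_inverse M = Some B"
    using mat_inverse(1)[OF M, where b = "()"] det_non_zero_imp_unit[OF M d, of "()"] by (cases "mat_inverse M") auto
  with mat_inverse(2)[OF M B] have MB: "M * B = 1\<^sub>m t" "B \<in> carrier_mat t t" by auto
  have "det M \<cdot>\<^sub>m B = (adj_mat M * M) * B" using MB a by (simp add: mult_smult_assoc_mat[of _ t t _ t])
  also have "\<dots> = adj_mat M" using MB M a(1) by (simp add: assoc_mult_mat[of _ t t _ t _ t])
  finally have "det M \<cdot>\<^sub>m B = adj_mat M" .
  then have "det M * B $$ (i, j) = adj_mat M $$ (i, j)" if "i < t" "j < t" for i j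
    using that MB(2) by (metis carrier_matD index_smult_mat(1))
  then have "B = mat t t (\<lambda>(i, j). adj_mat M $$ (i, j) / det M)"
    using MB(2) d by (intro eq_matI) (auto simp: field_simps)
  with B show ?thesis by simp
qed

text \<open>Every entry, including the 0 and 1 of the identity block, is written over the one
  denominator \<open>det M\<close>. This makes all entries evaluable on the whole cell, where that
  determinant does not vanish.\<close>

lemma kernel_matrix_eq:
  fixes A :: "rat mpoly mat"
  assumes I: "I \<subseteq> {..<dim_row A}" "card I = t" and J: "J \<subseteq> {..<dim_col A}" "card J = t"
    and d: "det (submatrix A I J) \<noteq> 0"
  defines "m \<equiv> dim_col A"
  shows "kernel_matrix A I J \<in> carrier_mat m (m - t)"
    and "j < m \<Longrightarrow> l < m - t \<Longrightarrow>
      kernel_matrix A I J $$ (j, l) = Fraction_Field.Fract (kernel_num A I J j l) (det (submatrix A I J))"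
proof -
  show "kernel_matrix A I J \<in> carrier_mat m (m - t)"
    by (simp add: kernel_matrix_def Let_def m_def J)
  assume j: "j < m" and l: "l < m - t"
  define M where "M = submatrix A I J"
  have M: "M \<in> carrier_mat t t" unfolding M_def submatrix_eq_mat[OF I(1) J(1)] by (simp add: I J)
  note a = adj_mat[OF M]
  have fin: "finite J" using J(1) finite_subset by auto
  let ?B = "map_mat to_frac A"
  let ?M' = "submatrix ?B I (- J)"
  define W where "W = (- (the (mat_inverse (submatrix ?B I J)) * ?M')) @\<^sub>r 1\<^sub>m (m - card J)"
  define perm where "perm = sorted_list_of_set J @ sorted_list_of_set ({0..<m} - J)"
  have Mf: "submatrix ?B I J = map_mat to_frac M" by (simp add: to_frac.hom_submatrix M_def)
  have d': "det M \<noteq> 0" using d by (simp add: M_def)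
  have inv: "the (mat_inverse (submatrix ?B I J)) = mat t t (\<lambda>(i, j). to_frac (adj_mat M $$ (i, j)) / to_frac (det M))"
    unfolding Mf using M d' a(1)
    by (subst mat_inverse_eq_adj[of _ t]) (auto simp: to_frac.hom_adj_mat[OF M] intro!: eq_matI)
  have cardJ: "card {j. j < m \<and> j \<in> - J} = m - t" using card_compl_lessThan[OF J(1)] J(2) by (simp add: m_def)
  have M': "?M' = mat t (m - t) (\<lambda>(p, l). to_frac (A $$ (pick I p, pick (- J) l)))"
  proof (rule eq_matI)
    fix p k assume "p < dim_row (mat t (m - t) (\<lambda>(p, l). to_frac (A $$ (pick I p, pick (- J) l))))"
      "k < dim_col (mat t (m - t) (\<lambda>(p, l). to_frac (A $$ (pick I p, pick (- J) l))))"
    then have pk: "p < t" "k < m - t" by auto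
    have "pick I p < dim_row A" using pick_in_set_le[of p I] pk I by auto
    moreover have "pick (- J) k < m"
      using bij_betw_apply[OF bij_betw_pick_compl[OF J(1)], of k] pk J(2) by (simp add: m_def)
    ultimately show "?M' $$ (p, k) = mat t (m - t) (\<lambda>(p, l). to_frac (A $$ (pick I p, pick (- J) l))) $$ (p, k)"
      using pk I cardJ by (simp add: submatrix_def Int_lessThan m_def)
  qed (use I cardJ in \<open>auto simp: submatrix_def Int_lessThan m_def\<close>)
  have W1: "W $$ (q, l) = Fraction_Field.Fract (kernel_num A I J (pick J q) l) (det M)" if "q < t" for q
  proof -
    have "W $$ (q, l) = - (\<Sum>s<t. to_frac (adj_mat M $$ (q, s)) / to_frac (det M) * to_frac (A $$ (pick I s, pick (- J) l)))"
      using that l by (simp add: W_def append_rows_def inv M' scalar_prod_def atLeast0LessThan)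
    also have "\<dots> = to_frac (kernel_num A I J (pick J q) l) / to_frac (det M)"
      using that by (simp add: kernel_num_pivot J I M_def [symmetric] to_frac.hom_uminus to_frac.hom_sum
          to_frac.hom_mult sum_divide_distrib)
    finally show ?thesis using d' by (simp add: to_frac_divide)
  qed
  have W2: "W $$ (t + l', l) = Fraction_Field.Fract (kernel_num A I J (pick (- J) l') l) (det M)" if "l' < m - t" for l'
  proof -
    have "W $$ (t + l', l) = (if l' = l then 1 else 0)"
      using that l J(2) by (simp add: W_def append_rows_def inv M')
    also have "\<dots> = to_frac (kernel_num A I J (pick (- J) l') l) / to_frac (det M)"
      using that l d' J(2) by (simp add: kernel_num_nonpivot[OF J(1)] M_def m_def)
    finally show ?thesis using d' by (simp add: to_frac_divide)
  qed
  have cc: "card ({0..<m} - J) = m - t" using J fin by (simp add: card_Diff_subset m_def atLeast0LessThan)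
  have perm: "distinct perm" "length perm = m" using J fin cc
    by (auto simp: perm_def m_def card_mono dest: card_mono[OF finite_lessThan])
  have perm1: "perm ! q = pick J q" if "q < t" for q
    using that J(2) by (simp add: perm_def nth_append sorted_list_of_set_pick[OF fin])
  have perm2: "perm ! (t + l') = pick (- J) l'" if "l' < m - t" for l'
    using that J cc pick_compl[OF J(1), of l']
    by (simp add: perm_def nth_append sorted_list_of_set_pick fin atLeast0LessThan m_def)
  \<comment> \<open>\<open>perm\<close> has no repetitions, so the definite description inverts it
    and undoes the sorting into pivot and free columns.\<close>
  have the: "(THE q. q < m \<and> perm ! q = perm ! p) = p" if "p < m" for p
    using that perm by (intro the_equality) (auto simp: nth_eq_iff_index_eq)
  have Z: "kernel_matrix A I J $$ (j, l) = W $$ (THE q. q < m \<and> perm ! q = j, l)"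
    using j l J(2) by (simp add: kernel_matrix_def Let_def W_def perm_def m_def)
  have tm: "t \<le> m" using J card_mono[OF finite_lessThan J(1)] by (simp add: m_def)
  from J(1) j consider q where "q < t" "j = pick J q" | l' where "l' < m - t" "j = pick (- J) l'"
    unfolding m_def J(2) [symmetric] by (rule pivot_cases)
  then show "kernel_matrix A I J $$ (j, l) = Fraction_Field.Fract (kernel_num A I J j l) (det (submatrix A I J))"
  proof cases
    case (1 q)
    then show ?thesis using the[of q] tm Z W1[of q] by (simp add: perm1 M_def)
  next
    case (2 l')
    then show ?thesis using the[of "t + l'"] tm Z W2[of l'] by (simp add: perm2 M_def)
  qed
qed


section \<open>ParametricSol and specialization\<close>

lemma mpolys_cofactor:
  fixes A :: "'a::comm_ring_1 mpoly mat"
  assumes "A \<in> carrier_mat k k" "\<And>i j. i < k \<Longrightarrow> j < k \<Longrightarrow> A $$ (i, j) \<in> mpolys n"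
  shows "cofactor A i j \<in> mpolys n"
proof -
  have "(- 1) ^ (i + j) \<in> (mpolys n :: 'a mpoly set)" by (intro mpolys_power mpolys_uminus mpolys_1)
  moreover have "det (mat_delete A i j) \<in> mpolys n"
    by (rule mpolys_det) (use assms in \<open>auto simp: mat_delete_def\<close>)
  ultimately show ?thesis unfolding cofactor_def by (rule mpolys_mult)
qed

lemma mpolys_submatrix_det:
  fixes A :: "'a::comm_ring_1 mpoly mat"
  assumes "\<And>i j. i < dim_row A \<Longrightarrow> j < dim_col A \<Longrightarrow> A $$ (i, j) \<in> mpolys n"
  shows "det (submatrix A I J) \<in> mpolys n"
  by (rule mpolys_det) (auto simp: submatrix_def intro!: assms pick_le)

lemma mpolys_minors:
  fixes A :: "'a::comm_ring_1 mpoly mat"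
  assumes "\<And>i j. i < dim_row A \<Longrightarrow> j < dim_col A \<Longrightarrow> A $$ (i, j) \<in> mpolys n"
  shows "set (minors k A) \<subseteq> mpolys n"
  using mpolys_submatrix_det[OF assms] by (auto simp: minors_def)

lemma mpolys_kernel_num:
  fixes A :: "'a::comm_ring_1 mpoly mat"
  assumes A: "\<And>i j. i < dim_row A \<Longrightarrow> j < dim_col A \<Longrightarrow> A $$ (i, j) \<in> mpolys n"
    and I: "I \<subseteq> {..<dim_row A}" "card I = t" and J: "J \<subseteq> {..<dim_col A}" "card J = t"
    and l: "l < dim_col A - t" and j: "j < dim_col A"
  shows "kernel_num A I J j l \<in> mpolys n"
proof -
  define M where "M = submatrix A I J"
  have M: "M \<in> carrier_mat t t" unfolding M_def submatrix_eq_mat[OF I(1) J(1)] by (simp add: I J)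
  have pI: "pick I p < dim_row A" if "p < t" for p using pick_in_set_le[of p I] that I by auto
  have pJ: "pick J p < dim_col A" if "p < t" for p using pick_in_set_le[of p J] that J by auto
  have pc: "pick (- J) l < dim_col A"
    using bij_betw_apply[OF bij_betw_pick_compl[OF J(1)], of l] l J(2) by simp
  have Mn: "M $$ (p, q) \<in> mpolys n" if "p < t" "q < t" for p q
    using that by (simp add: M_def submatrix_eq_mat[OF I(1) J(1)] I J A pI pJ)
  have adj: "adj_mat M $$ (p, q) \<in> mpolys n" if "p < t" "q < t" for p q
    using that M mpolys_cofactor[OF M Mn] by (simp add: adj_mat_def)
  from J(1) j consider q where "q < t" "j = pick J q" | l' where "l' < dim_col A - t" "j = pick (- J) l'"
    unfolding J(2) [symmetric] by (rule pivot_cases)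
  then show ?thesis
  proof cases
    case (1 q)
    then show ?thesis
      by (auto simp: kernel_num_pivot I J M_def [symmetric] intro!: mpolys_uminus mpolys_sum mpolys_mult adj A pI pc)
  next
    case (2 l')
    then show ?thesis
      using l mpolys_submatrix_det[OF A] by (simp add: kernel_num_nonpivot[OF J(1)] J(2))
  qed
qed

context comm_ring_hom
begin

lemma hom_kernel_num:
  assumes I: "I \<subseteq> {..<dim_row A}" "card I = t" and J: "J \<subseteq> {..<dim_col A}" "card J = t"
    and l: "l < dim_col A - t" and j: "j < dim_col A"
  shows "kernel_num (map_mat hom A) I J j l = hom (kernel_num A I J j l)"
proof -
  define M where "M = submatrix A I J"
  have M: "M \<in> carrier_mat t t" unfolding M_def submatrix_eq_mat[OF I(1) J(1)] by (simp add: I J)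
  have pI: "pick I p < dim_row A" if "p < t" for p using pick_in_set_le[of p I] that I by auto
  have pc: "pick (- J) l < dim_col A"
    using bij_betw_apply[OF bij_betw_pick_compl[OF J(1)], of l] l J(2) by simp
  from J(1) j consider q where "q < t" "j = pick J q" | l' where "l' < dim_col A - t" "j = pick (- J) l'"
    unfolding J(2) [symmetric] by (rule pivot_cases)
  then show ?thesis
  proof cases
    case (1 q)
    then show ?thesis using adj_mat(1)[OF M] pI pc
      by (simp add: kernel_num_pivot I J hom_submatrix M_def [symmetric] hom_adj_mat[OF M] hom_uminus hom_sum hom_mult)
  next
    case (2 l')
    then show ?thesis
      using l by (simp add: kernel_num_nonpivot[OF J(1)] J(2) hom_submatrix)
  qed
qed

lemma hom_minors: "minors k (map_mat hom A) = map hom (minors k A)"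
  by (simp add: minors_def map_concat o_def hom_submatrix)

end

section \<open>Values of rational functions and specialization\<close>

lemma represents_Fract:
  "p \<in> mpolys n \<Longrightarrow> q \<in> mpolys n \<Longrightarrow> q \<noteq> 0 \<Longrightarrow> represents n (Fraction_Field.Fract p q) p q"
  by (simp add: represents_def)

text \<open>Two fractions for the same function satisfy p q' = p' q as polynomials. Evaluating this
  identity shows that the value does not depend on the fraction, which justifies the definite
  description in \<open>rf_eval\<close>.\<close>

lemma rf_eval_Fract:
  assumes "a \<in> carrier_vec n" "p \<in> mpolys n" "q \<in> mpolys n" "qeval a q \<noteq> 0"
  shows "rf_eval a (Fraction_Field.Fract p q) = qeval a p / qeval a q"
    and "rf_defined a (Fraction_Field.Fract p q)"
proof -
  have "q \<noteq> 0" using assms(4) by auto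
  then have r: "represents (dim_vec a) (Fraction_Field.Fract p q) p q" using assms by (auto intro: represents_Fract)
  then show "rf_defined a (Fraction_Field.Fract p q)" using assms(4) by (auto simp: rf_defined_def)
  show "rf_eval a (Fraction_Field.Fract p q) = qeval a p / qeval a q"
    unfolding rf_eval_def
  proof (rule the_equality)
    fix v assume "\<exists>p' q'. represents (dim_vec a) (Fraction_Field.Fract p q) p' q' \<and> qeval a q' \<noteq> 0 \<and> v = qeval a p' / qeval a q'"
    then obtain p' q' where *: "q' \<noteq> 0" "Fraction_Field.Fract p q = Fraction_Field.Fract p' q'" "qeval a q' \<noteq> 0" "v = qeval a p' / qeval a q'"
      by (auto simp: represents_def)
    from * \<open>q \<noteq> 0\<close> have "p * q' = p' * q" by (simp add: eq_fract)
    then have e: "qeval a p * qeval a q' = qeval a p' * qeval a q" by (metis qeval.hom_mult)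
    show "v = qeval a p / qeval a q"
      unfolding *(4) by (simp add: frac_eq_eq *(3) assms(4) e)
  qed (use r assms(4) in blast)
qed

lemma length_row_times:
  "Z \<in> carrier_mat (length gs) k \<Longrightarrow> length (row_times gs Z) = k"
  by (simp add: row_times_def)

lemma nth_row_times:
  assumes "Z \<in> carrier_mat (length gs) k" "l < k"
  shows "row_times gs Z ! l = (\<Sum>j<length gs. lift_coeffs (gs ! j) * Const (Z $$ (j, l)))"
  using assms by (simp add: row_times_def list_of_vec_index scalar_prod_def vec_of_list_index atLeast0LessThan mat_of_row_def)

lemma lookup_Const_mult: "Poly_Mapping.lookup (Const c * p) k = c * Poly_Mapping.lookup p k"
  for p :: "'a::comm_ring_1 mpoly"
  using lookup_single_mult[of 0 c p k] by (simp add: Const_def)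

lemma lookup_mult_Const: "Poly_Mapping.lookup (p * Const c) k = Poly_Mapping.lookup p k * c"
  for p :: "'a::comm_ring_1 mpoly"
  by (metis lookup_Const_mult mult.commute)

lemma lookup_lift_coeffs: "Poly_Mapping.lookup (lift_coeffs p) k = to_frac (Const (Poly_Mapping.lookup p k))"
  by (simp add: lift_coeffs_def lookup_map_zero)

lemma lookup_complexify: "Poly_Mapping.lookup (complexify p) k = of_rat (Poly_Mapping.lookup p k)"
  by (simp add: complexify_def lookup_map_zero)

lemma mpolys_lift_coeffs: "p \<in> mpolys n \<Longrightarrow> lift_coeffs p \<in> mpolys n"
proof -
  have "Poly_Mapping.keys (lift_coeffs p) \<subseteq> Poly_Mapping.keys p"
    by (auto simp: in_keys_iff lookup_lift_coeffs)
  then show "p \<in> mpolys n \<Longrightarrow> lift_coeffs p \<in> mpolys n" by (auto simp: mpolys_def)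
qed

lemma qeval_Const: "qeval a (Const c) = of_rat c"
  unfolding qeval_def by (rule comm_ring_hom.meval_Const[OF of_rat_comm_ring_hom])

text \<open>\<open>rf_eval\<close> is meaningful only where no pole interferes, so it is not pushed
  through sums of rational functions. Each coefficient is first brought over the single denominator
  d and then evaluated once.\<close>

lemma lookup_row_times:
  assumes "Z \<in> carrier_mat (length gs) k" "l < k" "d \<noteq> 0"
    and "\<And>j. j < length gs \<Longrightarrow> Z $$ (j, l) = Fraction_Field.Fract (num j) d"
  shows "Poly_Mapping.lookup (row_times gs Z ! l) e =
    Fraction_Field.Fract (\<Sum>j<length gs. Const (Poly_Mapping.lookup (gs ! j) e) * num j) d"
proof -
  have "Poly_Mapping.lookup (row_times gs Z ! l) e =
      (\<Sum>j<length gs. to_frac (Const (Poly_Mapping.lookup (gs ! j) e)) * (to_frac (num j) / to_frac d))"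
    by (simp add: nth_row_times[OF assms(1,2)] lookup_sum lookup_mult_Const lookup_lift_coeffs
        assms(4) to_frac_divide[OF assms(3)])
  also have "\<dots> = to_frac (\<Sum>j<length gs. Const (Poly_Mapping.lookup (gs ! j) e) * num j) / to_frac d"
    by (simp add: to_frac.hom_sum to_frac.hom_mult sum_divide_distrib)
  finally show ?thesis using assms(3) by (simp add: to_frac_divide)
qed

lemma lookup_lin_comb:
  "Poly_Mapping.lookup (lin_comb gs b) e = (\<Sum>j<length gs. b j * of_rat (Poly_Mapping.lookup (gs ! j) e))"
  by (simp add: lin_comb_def lookup_sum mpoly_scale_def lookup_Const_mult lookup_complexify)

lemma specialize_row_times:
  assumes Z: "Z \<in> carrier_mat (length gs) k" "l < k"
    and num: "\<And>j. j < length gs \<Longrightarrow> Z $$ (j, l) = Fraction_Field.Fract (num j) d"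
    and n: "\<And>j. j < length gs \<Longrightarrow> num j \<in> mpolys n" "d \<in> mpolys n"
    and a: "a \<in> carrier_vec n" "qeval a d \<noteq> 0"
  shows "specialize a (row_times gs Z ! l) = lin_comb gs (\<lambda>j. qeval a (num j) / qeval a d)"
    and "rf_defined a (Poly_Mapping.lookup (row_times gs Z ! l) e)"
proof -
  have d: "d \<noteq> 0" using a(2) by auto
  let ?s = "\<lambda>e. \<Sum>j<length gs. Const (Poly_Mapping.lookup (gs ! j) e) * num j"
  have s: "?s e \<in> mpolys n" for e by (intro mpolys_sum mpolys_mult mpolys_Const n) simp
  have look: "Poly_Mapping.lookup (row_times gs Z ! l) e = Fraction_Field.Fract (?s e) d" for e
    by (rule lookup_row_times[OF Z d]) (rule num)
  show "rf_defined a (Poly_Mapping.lookup (row_times gs Z ! l) e)"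
    using rf_eval_Fract(2)[OF a(1) s n(2) a(2)] by (simp add: look)
  \<comment> \<open>\<open>Poly_Mapping.map\<close> applies its function only on the support. It
    therefore acts uniformly on all coefficients once the function is known to send 0 to 0.\<close>
  have "rf_eval a (Fraction_Field.Fract 0 1) = 0"
    using rf_eval_Fract(1)[OF a(1) mpolys_0 mpolys_1] by simp
  then have 0: "rf_eval a 0 = 0" by (simp add: Zero_fract_def)
  show "specialize a (row_times gs Z ! l) = lin_comb gs (\<lambda>j. qeval a (num j) / qeval a d)"
  proof (rule poly_mapping_eqI)
    fix e
    show "Poly_Mapping.lookup (specialize a (row_times gs Z ! l)) e =
        Poly_Mapping.lookup (lin_comb gs (\<lambda>j. qeval a (num j) / qeval a d)) e"
      unfolding specialize_def lookup_map_zero[where \<phi> = "rf_eval a", OF 0] look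
        rf_eval_Fract(1)[OF a(1) s n(2) a(2)] lookup_lin_comb
      by (simp add: qeval.hom_sum qeval.hom_mult qeval_Const sum_divide_distrib mult.commute)
  qed
qed

section \<open>Spans and independence of finite families\<close>

lemma span_family:
  "mpoly.span (f ` {..<(k::nat)}) = range (\<lambda>c. \<Sum>l<k. mpoly_scale (c l) (f l :: 'a::field mpoly))"
proof
  let ?V = "range (\<lambda>c. \<Sum>l<k. mpoly_scale (c l) (f l))"
  have "mpoly.subspace ?V"
    unfolding mpoly.subspace_def
  proof (intro conjI ballI allI)
    show "0 \<in> ?V" by (rule image_eqI[of _ _ "\<lambda>_. 0"]) auto
    fix x assume "x \<in> ?V"
    then obtain c where c: "x = (\<Sum>l<k. mpoly_scale (c l) (f l))" by blast
    { fix y assume "y \<in> ?V"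
      then obtain e where e: "y = (\<Sum>l<k. mpoly_scale (e l) (f l))" by blast
      show "x + y \<in> ?V"
        by (rule image_eqI[of _ _ "\<lambda>l. c l + e l"])
          (auto simp: c e mpoly.scale_left_distrib sum.distrib) }
    fix s show "mpoly_scale s x \<in> ?V"
      by (rule image_eqI[of _ _ "\<lambda>l. s * c l"]) (auto simp: c mpoly.scale_sum_right)
  qed
  moreover have "f ` {..<k} \<subseteq> ?V"
  proof
    fix x assume "x \<in> f ` {..<k}"
    then obtain i where "i < k" "x = f i" by blast
    then have "x = (\<Sum>l<k. if l = i then f l else 0)" by simp
    also have "\<dots> = (\<Sum>l<k. mpoly_scale (if l = i then 1 else 0) (f l))" by (intro sum.cong) auto
    finally show "x \<in> ?V" by (intro image_eqI[of _ _ "\<lambda>l. if l = i then 1 else 0"]) simp_all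
  qed
  ultimately show "mpoly.span (f ` {..<k}) \<subseteq> ?V" by (simp add: mpoly.span_minimal)
  show "?V \<subseteq> mpoly.span (f ` {..<k})"
    by (intro image_subsetI mpoly.span_sum mpoly.span_scale mpoly.span_base) auto
qed

text \<open>Independence is a notion for sets, so repeated members must be excluded first. The
  hypothesis does this itself: coefficients 1 and -1 at two equal members would be a nontrivial
  relation.\<close>

lemma independent_family:
  fixes f :: "nat \<Rightarrow> 'a::field mpoly"
  assumes "\<And>c l. (\<Sum>l<k. mpoly_scale (c l) (f l)) = 0 \<Longrightarrow> l < k \<Longrightarrow> c l = 0"
  shows "mpoly.independent (f ` {..<k})"
proof -
  have inj: "inj_on f {..<k}"
  proof (rule inj_onI, rule ccontr)
    fix x y assume xy: "x \<in> {..<k}" "y \<in> {..<k}" "f x = f y" "x \<noteq> y"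
    let ?c = "\<lambda>l. (if l = x then 1 else 0) - (if l = y then 1 else 0) :: 'a"
    have "(\<Sum>l<k. mpoly_scale (?c l) (f l)) = 0"
      using xy by (simp add: mpoly.scale_left_diff_distrib sum_subtractf if_distrib[of "\<lambda>c. mpoly_scale c _"] cong: if_cong)
    from assms[OF this, of x] xy show False by simp
  qed
  show ?thesis
  proof (rule mpoly.independent_if_scalars_zero)
    fix u v assume "(\<Sum>x\<in>f ` {..<k}. mpoly_scale (u x) x) = 0" "v \<in> f ` {..<k}"
    then show "u v = 0" using assms[of "\<lambda>l. u (f l)"] by (auto simp: sum.reindex[OF inj])
  qed simp
qed

lemma complexify_inj: "complexify p = complexify q \<Longrightarrow> p = q"
  by (rule poly_mapping_eqI) (metis lookup_complexify of_rat_eq_iff)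

lemma spanned_by_eq: "spanned_by gs = range (lin_comb gs)"
proof -
  have "complexify ` set gs = (\<lambda>j. complexify (gs ! j)) ` {..<length gs}"
    by (auto simp: set_conv_nth)
  then show ?thesis by (simp add: spanned_by_def span_family lin_comb_def [abs_def])
qed

text \<open>Passes from independence of a set to that of the tuple. Distinctness survives
  complexification, so each polynomial determines its position and \<open>u\<close> carries the
  coefficients over.\<close>

lemma lin_comb_eq_0:
  assumes "lin_indep gs" "lin_comb gs b = 0" "j < length gs"
  shows "b j = 0"
proof -
  have ind: "mpoly.independent (complexify ` set gs)" and dist: "distinct gs"
    using assms(1) by (auto simp: lin_indep_def)
  let ?f = "\<lambda>j. complexify (gs ! j)"
  have inj: "inj_on ?f {..<length gs}"
    using dist by (auto simp: inj_on_def nth_eq_iff_index_eq dest!: complexify_inj)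
  have im: "?f ` {..<length gs} = complexify ` set gs" by (auto simp: set_conv_nth)
  define u where "u x = b (inv_into {..<length gs} ?f x)" for x
  have u: "u (?f j) = b j" if "j < length gs" for j
    using inv_into_f_f[OF inj, of j] that by (simp add: u_def)
  have "(\<Sum>x\<in>complexify ` set gs. mpoly_scale (u x) x) = lin_comb gs b"
    unfolding im [symmetric] lin_comb_def sum.reindex[OF inj] by (simp add: u)
  then have "u (?f j) = 0"
    using assms(2,3) by (intro mpoly.independentD[OF ind]) auto
  then show ?thesis using u[OF assms(3)] by simp
qed

lemma lin_comb_cong: "(\<And>j. j < length gs \<Longrightarrow> b j = b' j) \<Longrightarrow> lin_comb gs b = lin_comb gs b'"
  by (simp add: lin_comb_def)

lemma lin_comb_sum: "(\<Sum>l<k. mpoly_scale (c l) (lin_comb gs (w l))) = lin_comb gs (\<lambda>j. \<Sum>l<k. c l * w l j)"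
  unfolding lin_comb_def by (simp add: mpoly.scale_sum_right mpoly.scale_sum_left) (rule sum.swap)

section \<open>Counting the cells and covering the space\<close>

lemma length_concat_le:
  "(\<And>x. x \<in> set xs \<Longrightarrow> length (f x) \<le> B) \<Longrightarrow> length (concat (map f xs)) \<le> length xs * B"
  by (induction xs) (auto intro: add_mono)

text \<open>The filter keeps at most one entry per pair of index sets. Reflecting the row binomial
  gives the sum the shape of Vandermonde's convolution, and extending it to all t up to the number
  of rows can only enlarge it.\<close>

lemma length_ParametricSol:
  "length (ParametricSol A) \<le> (dim_col A + dim_row A) choose dim_row A"
proof -
  let ?r = "dim_row A" and ?m = "dim_col A"
  have *: "length (concat (map (\<lambda>I. concat (map (f I) (index_sets ?m t))) (index_sets ?r t))) \<le> (?r choose t) * (?m choose t)"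
    if "\<And>I J. length (f I J) \<le> 1" for f :: "nat set \<Rightarrow> nat set \<Rightarrow> 'b list" and t
  proof -
    have "length (concat (map (f I) (index_sets ?m t))) \<le> (?m choose t)" for I
      using length_concat_le[of "index_sets ?m t" "f I" 1] that by (simp add: length_index_sets)
    then show ?thesis
      using length_concat_le[of "index_sets ?r t" "\<lambda>I. concat (map (f I) (index_sets ?m t))"]
      by (simp add: length_index_sets)
  qed
  have sym: "(?r choose t) * (?m choose t) = (?m choose t) * (?r choose (?r - t))" if "t \<le> ?r" for t
    using binomial_symmetric[OF that] by simp
  have "length (ParametricSol A) \<le> (\<Sum>t\<leftarrow>[0..<Suc (min ?r ?m)]. (?r choose t) * (?m choose t))"
    unfolding ParametricSol_def length_concat map_map
    by (rule sum_list_mono) (simp only: o_apply, rule *, simp)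
  also have "\<dots> = (\<Sum>t\<le>min ?r ?m. (?r choose t) * (?m choose t))"
    by (simp add: interv_sum_list_conv_sum_set_nat atLeast0LessThan lessThan_Suc_atMost del: upt_Suc)
  also have "\<dots> = (\<Sum>t\<le>min ?r ?m. (?m choose t) * (?r choose (?r - t)))"
    by (rule sum.cong[OF refl], rule sym) simp
  also have "\<dots> \<le> (\<Sum>t\<le>?r. (?m choose t) * (?r choose (?r - t)))"
    by (rule sum_mono2) auto
  also have "\<dots> = (?m + ?r) choose ?r" by (rule vandermonde)
  finally show ?thesis .
qed

text \<open>As \<open>to_frac\<close> is injective and commutes with determinants, nonsingularity
  over the rational functions says that the determinant is a nonzero polynomial.\<close>

lemma in_ParametricSol:
  "x \<in> set (ParametricSol A) \<longleftrightarrow> (\<exists>t I J. t \<le> min (dim_row A) (dim_col A) \<and>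
     I \<subseteq> {..<dim_row A} \<and> card I = t \<and> J \<subseteq> {..<dim_col A} \<and> card J = t \<and> det (submatrix A I J) \<noteq> 0 \<and>
     x = ((minors (Suc t) A, [det (submatrix A I J)]), kernel_matrix A I J))"
proof -
  define X where "X t I J = ((minors (t + 1) A, [det (submatrix A I J)]), kernel_matrix A I J)" for t I J
  have P: "ParametricSol A = [X t I J. t \<leftarrow> [0..<Suc (min (dim_row A) (dim_col A))],
       I \<leftarrow> index_sets (dim_row A) t, J \<leftarrow> index_sets (dim_col A) t,
       det (submatrix (map_mat to_frac A) I J) \<noteq> 0]"
    unfolding ParametricSol_def X_def ..
  have X: "((minors (Suc t) A, [det (submatrix A I J)]), kernel_matrix A I J) = X t I J" for t I J
    by (simp add: X_def)
  have "x \<in> set (ParametricSol A) \<longleftrightarrow> (\<exists>t\<in>{0..<Suc (min (dim_row A) (dim_col A))}.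
      \<exists>I\<in>set (index_sets (dim_row A) t). \<exists>J\<in>set (index_sets (dim_col A) t).
        det (submatrix A I J) \<noteq> 0 \<and> x = X t I J)"
    unfolding P by (simp add: to_frac.hom_submatrix del: upt_Suc) blast
  then show ?thesis unfolding X
    by (simp only: in_index_sets Bex_def atLeastLessThan_iff less_Suc_eq_le) blast
qed

text \<open>A point lies in a cell given by a nonvanishing minor of maximal size.\<close>
lemma ParametricSol_covers:
  assumes "a \<in> carrier_vec n"
  obtains D Z where "(D, Z) \<in> set (ParametricSol A)" "a \<in> constructible n D"
proof -
  let ?P = "\<lambda>t. \<exists>x\<in>set (minors t A). qeval a x \<noteq> 0"
  have le: "t \<le> min (dim_row A) (dim_col A)" if "?P t" for t
  proof -
    from that obtain I J where "I \<subseteq> {..<dim_row A}" "card I = t" "J \<subseteq> {..<dim_col A}" "card J = t"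
      by (auto simp: minors_def in_index_sets)
    then show ?thesis using card_mono[of "{..<dim_row A}" I] card_mono[of "{..<dim_col A}" J] by auto
  qed
  \<comment> \<open>The empty minor is 1, so size 0 always qualifies and a largest size
    exists.\<close>
  have "det (submatrix A {} {}) \<in> set (minors 0 A)"
    by (rule det_submatrix_in_minors) (simp_all add: in_index_sets)
  moreover have "det (submatrix A {} {}) = 1"
    by (rule det_dim_zero, rule carrier_matI) (simp_all add: dim_submatrix)
  ultimately have P0: "?P 0" by (intro bexI[of _ "det (submatrix A {} {})"]) (simp_all only: qeval.hom_one one_neq_zero not_False_eq_True)
  define t where "t = (GREATEST t. ?P t)"
  have t: "?P t" unfolding t_def using P0 by (rule GreatestI_nat) (rule le)
  have nP: "\<not> ?P (Suc t)"
  proof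
    assume "?P (Suc t)"
    then have "Suc t \<le> t" unfolding t_def by (rule Greatest_le_nat) (rule le)
    then show False by simp
  qed
  from t obtain I J where IJ: "I \<subseteq> {..<dim_row A}" "card I = t" "J \<subseteq> {..<dim_col A}" "card J = t"
    "qeval a (det (submatrix A I J)) \<noteq> 0"
    by (auto simp: minors_def in_index_sets)
  let ?D = "(minors (Suc t) A, [det (submatrix A I J)])"
  have "det (submatrix A I J) \<noteq> 0" using IJ(5) by auto
  then have "(?D, kernel_matrix A I J) \<in> set (ParametricSol A)"
    unfolding in_ParametricSol using IJ le[OF t] by blast
  moreover have "a \<in> constructible n ?D" using assms nP IJ(5) by (auto simp: constructible_def)
  ultimately show ?thesis by (rule that)
qed


section \<open>TruncatedClass\<close>

lemma cm_matrix_mpolys: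
  assumes "set gs \<subseteq> mpolys (length F)" "set hs \<subseteq> mpolys (length F)" "set F \<subseteq> mpolys (length F)"
    and "i < N" "j < length gs"
  shows "cm_matrix gs hs F N $$ (i, j) \<in> mpolys (length F)"
  using assms nth_mem[OF assms(5)]
  by (auto simp: cm_matrix_def intro!: mpolys_mult guard_prod_mpolys comp_iter_mpolys)

text \<open>What one cell contributes, for an arbitrary polynomial matrix and without reference to a
  loop. The span is described for every tuple; a relation among the g_j may send independent kernel
  vectors to dependent polynomials, whence the condition in the last part.\<close>

lemma kernel_cell:
  fixes A :: "rat mpoly mat"
  assumes gs: "set gs \<subseteq> mpolys n" "length gs = dim_col A"
    and A: "\<And>i j. i < dim_row A \<Longrightarrow> j < dim_col A \<Longrightarrow> A $$ (i, j) \<in> mpolys n"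
    and cell: "(D, Z) \<in> set (ParametricSol A)"
  shows "set (fst D) \<union> set (snd D) \<subseteq> mpolys n"
    and "f \<in> set (row_times gs Z) \<Longrightarrow> f \<in> mpolys n \<and> (\<forall>e. Poly_Mapping.lookup f e \<in> rat_funs n)"
    and "a \<in> constructible n D \<Longrightarrow> f \<in> set (row_times gs Z) \<Longrightarrow> rf_defined a (Poly_Mapping.lookup f e)"
    and "a \<in> constructible n D \<Longrightarrow> mpoly.span (specialize a ` set (row_times gs Z)) =
       {lin_comb gs b | b. \<forall>i<dim_row A. (\<Sum>j<dim_col A. qeval a (A $$ (i, j)) * b j) = 0}"
    and "a \<in> constructible n D \<Longrightarrow> lin_indep gs \<Longrightarrow> mpoly.independent (specialize a ` set (row_times gs Z))"
proof -
  from cell obtain t I J where I: "I \<subseteq> {..<dim_row A}" "card I = t"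
    and J: "J \<subseteq> {..<dim_col A}" "card J = t" and d0: "det (submatrix A I J) \<noteq> 0"
    and D: "D = (minors (Suc t) A, [det (submatrix A I J)])" and Z: "Z = kernel_matrix A I J"
    unfolding in_ParametricSol by blast
  define m where "m = dim_col A"
  define d where "d = det (submatrix A I J)"
  have d: "d \<in> mpolys n" "d \<noteq> 0" using mpolys_submatrix_det[OF A] d0 by (simp_all add: d_def)
  have num: "kernel_num A I J j l \<in> mpolys n" if "j < m" "l < m - t" for j l
    using mpolys_kernel_num[OF A I J] that by (simp add: m_def)
  have m: "length gs = m" using gs(2) by (simp add: m_def)
  have Zc: "Z \<in> carrier_mat (length gs) (m - t)"
    using kernel_matrix_eq(1)[OF I J d0] by (simp add: Z m_def gs(2))
  have Ze: "Z $$ (j, l) = Fraction_Field.Fract (kernel_num A I J j l) d" if "j < length gs" "l < m - t" for j l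
    using kernel_matrix_eq(2)[OF I J d0, of j l] that by (simp add: Z m_def gs(2) d_def)
  have T: "set (row_times gs Z) = (\<lambda>l. row_times gs Z ! l) ` {..<m - t}"
    using length_row_times[OF Zc] by (auto simp: set_conv_nth)
  show "set (fst D) \<union> set (snd D) \<subseteq> mpolys n"
    using mpolys_minors[OF A, of "Suc t"] d(1) by (simp add: D d_def)
  show "f \<in> mpolys n \<and> (\<forall>e. Poly_Mapping.lookup f e \<in> rat_funs n)" if "f \<in> set (row_times gs Z)"
  proof -
    from that T obtain l where l: "l < m - t" "f = row_times gs Z ! l" by auto
    have "gs ! j \<in> mpolys n" if "j < length gs" for j using nth_mem[OF that] gs(1) by blast
    then have "f \<in> mpolys n"
      unfolding l(2) nth_row_times[OF Zc l(1)]
      by (intro mpolys_sum mpolys_mult mpolys_lift_coeffs mpolys_Const) simp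
    moreover have "Poly_Mapping.lookup f e \<in> rat_funs n" for e
    proof -
      have "(\<Sum>j<length gs. Const (Poly_Mapping.lookup (gs ! j) e) * kernel_num A I J j l) \<in> mpolys n"
        using l m by (intro mpolys_sum mpolys_mult mpolys_Const num) auto
      moreover have "Poly_Mapping.lookup f e =
          Fraction_Field.Fract (\<Sum>j<length gs. Const (Poly_Mapping.lookup (gs ! j) e) * kernel_num A I J j l) d"
        unfolding l(2) by (rule lookup_row_times[OF Zc l(1) d(2)]) (simp add: Ze l)
      ultimately show ?thesis using represents_Fract[OF _ d] by (auto simp: rat_funs_def)
    qed
    ultimately show ?thesis by blast
  qed
  assume aD: "a \<in> constructible n D"
  then have a: "a \<in> carrier_vec n" "\<And>x. x \<in> set (minors (Suc t) A) \<Longrightarrow> qeval a x = 0" "qeval a d \<noteq> 0"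
    by (auto simp: constructible_def D d_def)
  define w where "w l j = qeval a (kernel_num A I J j l) / qeval a d" for l j
  have spec: "specialize a (row_times gs Z ! l) = lin_comb gs (w l)"
    and def: "rf_defined a (Poly_Mapping.lookup (row_times gs Z ! l) e)" if "l < m - t" for l e
  proof -
    have nl: "kernel_num A I J j l \<in> mpolys n" if "j < length gs" for j
      using num[of j l] that \<open>l < m - t\<close> m by simp
    note sp = specialize_row_times[OF Zc that Ze[OF _ that] nl d(1) a(1,3)]
    show "specialize a (row_times gs Z ! l) = lin_comb gs (w l)"
      unfolding w_def by (rule sp(1)) simp_all
    show "rf_defined a (Poly_Mapping.lookup (row_times gs Z ! l) e)"
      by (rule sp(2)) simp_all
  qed
  show "rf_defined a (Poly_Mapping.lookup f e)" if "f \<in> set (row_times gs Z)" for f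
    using that def unfolding T by auto
  have sT: "specialize a ` set (row_times gs Z) = (\<lambda>l. lin_comb gs (w l)) ` {..<m - t}"
    unfolding T image_image using spec by auto
  \<comment> \<open>The parametrization is applied to the evaluated matrix A(a). Its numerators are
    the evaluated numerators of A, since they are polynomial expressions in the entries.\<close>
  define B where "B = map_mat (qeval a) A"
  have B: "dim_row B = dim_row A" "dim_col B = m" by (simp_all add: B_def m_def)
  have detB: "det (submatrix B I J) = qeval a d" by (simp add: B_def qeval.hom_submatrix d_def)
  have w: "w l j = kernel_num B I J j l / det (submatrix B I J)" if "l < m - t" "j < m" for l j
    unfolding w_def detB using that qeval.hom_kernel_num[OF I J, of l j a] by (simp add: B_def m_def)
  have ker: "(\<forall>i<dim_row A. (\<Sum>j<m. qeval a (A $$ (i, j)) * b j) = 0) \<longleftrightarrow>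
      (\<exists>c. \<forall>j<m. b j = (\<Sum>l<m - t. c l * w l j))" for b
  proof -
    have "x = 0" if "x \<in> set (minors (Suc t) B)" for x
      using that a(2) by (auto simp: B_def qeval.hom_minors)
    from kernel_parametrization[where A = B and I = I and J = J and t = t and b = b, OF this] I J a(3)
    have "(\<forall>i<dim_row A. (\<Sum>j<m. B $$ (i, j) * b j) = 0) \<longleftrightarrow>
        (\<exists>c. \<forall>j<m. b j = (\<Sum>l<m - t. c l * (kernel_num B I J j l / det (submatrix B I J))))"
      by (simp add: B detB m_def)
    then show ?thesis by (simp add: w B_def m_def)
  qed
  have "mpoly.span (specialize a ` set (row_times gs Z)) =
      range (\<lambda>c. lin_comb gs (\<lambda>j. \<Sum>l<m - t. c l * w l j))"
    unfolding sT span_family lin_comb_sum ..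
  also have "\<dots> = {lin_comb gs b | b. \<forall>i<dim_row A. (\<Sum>j<m. qeval a (A $$ (i, j)) * b j) = 0}"
    (is "_ = ?K")
  proof
    show "range (\<lambda>c. lin_comb gs (\<lambda>j. \<Sum>l<m - t. c l * w l j)) \<subseteq> ?K"
      unfolding ker by blast
    show "?K \<subseteq> range (\<lambda>c. lin_comb gs (\<lambda>j. \<Sum>l<m - t. c l * w l j))"
    proof
      fix x assume "x \<in> ?K"
      then obtain b c where "x = lin_comb gs b" "\<forall>j<m. b j = (\<Sum>l<m - t. c l * w l j)"
        unfolding ker by blast
      then have "x = lin_comb gs (\<lambda>j. \<Sum>l<m - t. c l * w l j)"
        by (auto intro!: lin_comb_cong simp: m)
      then show "x \<in> range (\<lambda>c. lin_comb gs (\<lambda>j. \<Sum>l<m - t. c l * w l j))" by blast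
    qed
  qed
  finally show "mpoly.span (specialize a ` set (row_times gs Z)) =
       {lin_comb gs b | b. \<forall>i<dim_row A. (\<Sum>j<dim_col A. qeval a (A $$ (i, j)) * b j) = 0}"
    by (simp add: m_def)
  show "mpoly.independent (specialize a ` set (row_times gs Z))" if ind: "lin_indep gs"
    unfolding sT
  proof (rule independent_family)
    fix c l assume "(\<Sum>l<m - t. mpoly_scale (c l) (lin_comb gs (w l))) = 0" and l: "l < m - t"
    then have z: "lin_comb gs (\<lambda>j. \<Sum>l<m - t. c l * w l j) = 0" by (simp add: lin_comb_sum)
    have p: "pick (- J) l < m"
      using bij_betw_apply[OF bij_betw_pick_compl[OF J(1)], of l] l J(2) by (simp add: m_def)
    \<comment> \<open>At the l-th free column the identity block leaves only the coefficient
      \<open>c l\<close>. Independence of the g_j makes every coordinate of the combination zero, so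
      this one vanishes.\<close>
    have "(\<Sum>l'<m - t. c l' * w l' (pick (- J) l)) = (\<Sum>l'<m - t. if l' = l then c l' else 0)"
      using l a(3) J(2)
      by (intro sum.cong) (auto simp: w_def kernel_num_nonpivot[OF J(1)] m_def d_def)
    then have "(\<Sum>l'<m - t. c l' * w l' (pick (- J) l)) = c l" using l by simp
    with lin_comb_eq_0[OF ind z, of "pick (- J) l"] p m show "c l = 0" by simp
  qed
qed

theorem theorem4p4:
  fixes gs hs F :: "rat mpoly list" and m n :: nat
  assumes "set gs \<subseteq> mpolys n" and "set hs \<subseteq> mpolys n" and "set F \<subseteq> mpolys n"
    and "length gs = m" and "length F = n"
  shows "\<exists>out. TruncatedClass gs hs F = Some out \<and>
    (let k = length out;
         S = (\<lambda>i. constructible n (fst (out ! i)));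
         T = (\<lambda>i. set (snd (out ! i)));
         I = (\<lambda>a. invariants_in a hs F (spanned_by gs));
         N = InvariantSet_iterations (cm_input gs F) (cm_map gs hs F)
     in
       (\<forall>i<k. set (fst (fst (out ! i))) \<union> set (snd (fst (out ! i))) \<subseteq> mpolys n) \<and>
       (\<forall>i<k. \<forall>f\<in>T i. f \<in> mpolys n \<and> (\<forall>mon. Poly_Mapping.lookup f mon \<in> rat_funs n)) \<and>
       (carrier_vec n :: complex vec set) = (\<Union>i<k. S i) \<and>
       (\<forall>i<k. \<forall>a\<in>S i.
          (\<forall>f\<in>T i. \<forall>mon. rf_defined a (Poly_Mapping.lookup f mon)) \<and>
          mpoly.span (specialize a ` T i) = I a \<and>
          (lin_indep gs \<longrightarrow> is_basis (specialize a ` T i) (I a))) \<and>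
       k \<le> (m + N) choose N)"
proof -
  define N where "N = InvariantSet_iterations (cm_input gs F) (cm_map gs hs F)"
  define A where "A = cm_matrix gs hs F N"
  define out where "out = map (\<lambda>(D, Z). (D, row_times gs Z)) (ParametricSol A)"
  have sub: "set gs \<subseteq> mpolys (length F)" "set hs \<subseteq> mpolys (length F)" "set F \<subseteq> mpolys (length F)"
    using assms by auto
  have dim: "dim_row A = N" "dim_col A = m" using assms(4) by (simp_all add: A_def cm_matrix_def)
  have A: "A $$ (i, j) \<in> mpolys n" if "i < dim_row A" "j < dim_col A" for i j
    using cm_matrix_mpolys[OF sub, of i N j] that dim assms(4,5) by (simp add: A_def)
  have out: "TruncatedClass gs hs F = Some out"
    by (simp add: TruncatedClass_def ComputeMatrix_eq[OF sub] out_def A_def N_def)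
  have gs: "set gs \<subseteq> mpolys n" "length gs = dim_col A" using assms dim by auto
  have nth: "\<exists>D Z. (D, Z) \<in> set (ParametricSol A) \<and> out ! i = (D, row_times gs Z)" if "i < length out" for i
    using that nth_mem[of i "ParametricSol A"] by (cases "ParametricSol A ! i") (auto simp: out_def)
  \<comment> \<open>The kernel criterion holds for each coefficient vector that represents a given
    polynomial, so this equality also covers tuples with linear relations.\<close>
  have inv: "invariants_in a hs F (spanned_by gs) =
      {lin_comb gs b | b. \<forall>i<dim_row A. (\<Sum>j<dim_col A. qeval a (A $$ (i, j)) * b j) = 0}" for a
    using invariant_iff_kernel[OF sub N_def, of a] dim assms(4)
    by (auto simp: invariants_in_def spanned_by_eq A_def)
  have cover: "\<exists>i<length out. a \<in> constructible n (fst (out ! i))" if a: "a \<in> carrier_vec n" for a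
  proof -
    obtain D Z where DZ: "(D, Z) \<in> set (ParametricSol A)" "a \<in> constructible n D"
      using ParametricSol_covers[OF a] by blast
    then obtain i where "i < length (ParametricSol A)" "ParametricSol A ! i = (D, Z)"
      by (auto simp: in_set_conv_nth)
    with DZ show ?thesis by (intro exI[of _ i]) (simp add: out_def)
  qed
  have union: "carrier_vec n = (\<Union>i<length out. constructible n (fst (out ! i)))"
  proof
    show "carrier_vec n \<subseteq> (\<Union>i<length out. constructible n (fst (out ! i)))"
      using cover by blast
  qed (auto simp: constructible_def)
  \<comment> \<open>The matrix has one row per iteration and one column per g_j, which fixes both
    arguments of the binomial.\<close>
  have bound: "length out \<le> (m + N) choose N"
    using length_ParametricSol[of A] dim by (simp add: out_def)
  have desc: "set (fst (fst (out ! i))) \<union> set (snd (fst (out ! i))) \<subseteq> mpolys n" if "i < length out" for i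
  proof -
    from nth[OF that] obtain D Z where DZ: "(D, Z) \<in> set (ParametricSol A)" "out ! i = (D, row_times gs Z)"
      by blast
    from kernel_cell(1)[OF gs A DZ(1)] show ?thesis by (simp add: DZ(2))
  qed
  have polys: "f \<in> mpolys n \<and> (\<forall>e. Poly_Mapping.lookup f e \<in> rat_funs n)"
    if "i < length out" "f \<in> set (snd (out ! i))" for i f
  proof -
    from nth[OF that(1)] obtain D Z where DZ: "(D, Z) \<in> set (ParametricSol A)" "out ! i = (D, row_times gs Z)"
      by blast
    from that(2) have "f \<in> set (row_times gs Z)" by (simp add: DZ(2))
    from kernel_cell(2)[OF gs A DZ(1) this] show ?thesis by simp
  qed
  have basis: "(\<forall>f\<in>set (snd (out ! i)). \<forall>e. rf_defined a (Poly_Mapping.lookup f e)) \<and>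
      mpoly.span (specialize a ` set (snd (out ! i))) = invariants_in a hs F (spanned_by gs) \<and>
      (lin_indep gs \<longrightarrow> is_basis (specialize a ` set (snd (out ! i))) (invariants_in a hs F (spanned_by gs)))"
    if "i < length out" "a \<in> constructible n (fst (out ! i))" for i a
  proof -
    from nth[OF that(1)] obtain D Z where DZ: "(D, Z) \<in> set (ParametricSol A)" "out ! i = (D, row_times gs Z)"
      by blast
    with that(2) have a: "a \<in> constructible n D" by simp
    show ?thesis
      using kernel_cell(3-5)[OF gs A DZ(1) a] by (simp add: DZ(2) inv is_basis_def)
  qed
  show ?thesis
    unfolding Let_def N_def [symmetric]
    using out union bound desc polys basis by blast
qed

end
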